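(* Let $\Phi(z)=\exp(-z)$. For two $\eta$-Lipschitz standardized star shapes $X_1,X_2\in\mathcal S_{\star,\eta}$, one can compute a distance $D$ such that $|D-\mathtt d_\Phi(X_1,X_2)|\le\varepsilon$ in $O\big(\frac{1}{\eta\varepsilon}\log\frac{1}{\eta\varepsilon}\big)$ time.
   Context: A standardized shape is a compact set $X\subset\mathbb R^2$ that is mean centered (its mean point is the origin) and satisfies $\max_{x\in X}\|x\|\le1$. It is a standardized star shape if moreover every $x\in X$ can be joined to the origin by a line segment contained in $X$; then the ray from the origin at angle $\theta$ meets $X$ exactly in the points at distance in $[0,X(\theta)]$ from the origin, with $X(\theta)\in(0,1]$. Such an $X$ belongs to $\mathcal S_{\star,\eta}$ (is $\eta$-Lipschitz) if $|X(\theta)-X(\theta')|\le\eta\,\frac{1}{2\pi}|\theta-\theta'|$ for all angles $\theta,\theta'$. $\mathtt d_\Phi(X_1,X_2)$ is the distance between the rotation-invariant sketches of $X_1$ and $X_2$. For shapes whose radius is constant, equal to $f(j)$, on each wedge of angles $[j\frac{2\pi}{m},(j+1)\frac{2\pi}{m})$, $j\in[m]=\{0,\dots,m-1\}$, the sketch is the vector $V_f\in\mathbb R^m$ with $V_f(k)=\frac1m\sum_{j\in[m]}\Phi(f(j)-f(j+k))$ (indices modulo $m$), and $\mathtt d_\Phi(X_1,X_2)=\|V_{f_1}-V_{f_2}\|$. For a general star shape the sketch is the function $\psi_X(\alpha)=\frac1{2\pi}\int_0^{2\pi}\Phi\big(X(\theta)-X(\theta+\alpha)\big)\,d\theta$,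 $\alpha\in[0,2\pi)$ (with $X(\cdot)$ taken $2\pi$-periodic), and sketches are compared in the norm $\|\psi_1-\psi_2\|_{L_2}=\big(\frac1{2\pi}\int_0^{2\pi}(\psi_1(\alpha)-\psi_2(\alpha))^2\,d\alpha\big)^{1/2}$.
   Formalization: The O-constant is uniform over 0<η≤η0 for each fixed η0 (not over all η>0, where the claim fails as η→∞ with ηε=1/2), and the time bound is asserted for ηε≤1/2, where the logarithm is bounded away from 0. *)

theory Defs
  imports "HOL-Analysis.Analysis"
begin

section \<open>Star shapes\<close>

text \<open>The centroid with respect to area. For a null set the quotient degenerates to 0, but a
  compact star shape with positive radius in every direction has positive area.\<close>

definition mean_point :: "(real^2) set \<Rightarrow> real^2" where
  "mean_point X = (1 / measure lebesgue X) *\<^sub>R integral X (\<lambda>x. x)"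

definition standardized_shape :: "(real^2) set \<Rightarrow> bool" where
  "standardized_shape X \<longleftrightarrow>
     compact X \<and> X \<noteq> {} \<and> mean_point X = 0 \<and> (\<forall>x\<in>X. norm x \<le> 1)"

text \<open>The function \<open>X(\<theta>)\<close>, defined for all real angles and hence \<open>2\<pi>\<close>-periodic. The supremum is
  attained because \<open>X\<close> is compact.\<close>

definition radius :: "(real^2) set \<Rightarrow> real \<Rightarrow> real" where
  "radius X \<theta> = Sup {r. 0 \<le> r \<and> r *\<^sub>R vector [cos \<theta>, sin \<theta>] \<in> X}"

text \<open>Positivity of the radius is a genuine requirement: closedness under segments to the origin
  would also allow directions in which the shape consists of the origin only. The bound
  \<open>radius X \<theta> \<le> 1\<close> follows from the bound on the norm.\<close>

definition standardized_star_shape :: "(real^2) set \<Rightarrow> bool" where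
  "standardized_star_shape X \<longleftrightarrow>
     standardized_shape X \<and> (\<forall>x\<in>X. closed_segment 0 x \<subseteq> X) \<and> (\<forall>\<theta>. 0 < radius X \<theta>)"

definition lipschitz_star_shapes :: "real \<Rightarrow> (real^2) set set" where
  "lipschitz_star_shapes \<eta> =
     {X. standardized_star_shape X \<and> (\<eta> * (1 / (2 * pi)))-lipschitz_on UNIV (radius X)}"


section \<open>The rotation-invariant sketch and its distance\<close>

definition sketch :: "(real \<Rightarrow> real) \<Rightarrow> (real^2) set \<Rightarrow> real \<Rightarrow> real" where
  "sketch \<Phi> X \<alpha> =
     1 / (2 * pi) * integral {0..2 * pi} (\<lambda>\<theta>. \<Phi> (radius X \<theta> - radius X (\<theta> + \<alpha>)))"

definition sketch_dist :: "(real \<Rightarrow> real) \<Rightarrow> (real^2) set \<Rightarrow> (real^2) set \<Rightarrow> real" where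
  "sketch_dist \<Phi> X1 X2 =
     sqrt (1 / (2 * pi) * integral {0..2 * pi} (\<lambda>\<alpha>. (sketch \<Phi> X1 \<alpha> - sketch \<Phi> X2 \<alpha>)\<^sup>2))"


section \<open>Computation time: a real RAM with access to two radius functions\<close>

text \<open>Running time is measured on a real RAM in the sense of Preparata and Shamos: exact real
  arithmetic, comparisons, indirect addressing, and square root, exponential and trigonometric
  functions, all at unit cost. The input shapes are accessed by evaluating their radius functions
  at an angle, also at unit cost. There is no rounding of reals to integers; natural numbers used
  for addressing live in separate registers that admit only addition and (truncated) subtraction.
  The memory consists of index registers and of real arrays, both named by natural numbers.\<close>

datatype iexp = INum nat | IReg nat | IAdd iexp iexp | ISub iexp iexp

datatype rexp =
    OfIdx iexp | Pi | Cell nat iexp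
  | Add rexp rexp | Sub rexp rexp | Mul rexp rexp | Div rexp rexp
  | Sqrt rexp | Exp rexp | Sin rexp | Cos rexp
  | Radius1 rexp | Radius2 rexp

text \<open>The conditions of \<open>IfLess e1 e2\<close> and \<open>WhileLess e1 e2\<close> are \<open>e1 < e2\<close>.\<close>

datatype com =
    Skip
  | ISet nat iexp
  | RSet nat iexp rexp
  | Seq com com
  | IfLess rexp rexp com com
  | WhileLess rexp rexp com

type_synonym state = "(nat \<Rightarrow> nat) \<times> (nat \<Rightarrow> nat \<Rightarrow> real)"

fun ival :: "iexp \<Rightarrow> state \<Rightarrow> nat" where
  "ival (INum n) s = n"
| "ival (IReg v) s = fst s v"
| "ival (IAdd a b) s = ival a s + ival b s"
| "ival (ISub a b) s = ival a s - ival b s"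

fun rval :: "(real \<Rightarrow> real) \<Rightarrow> (real \<Rightarrow> real) \<Rightarrow> rexp \<Rightarrow> state \<Rightarrow> real" where
  "rval \<rho>1 \<rho>2 (OfIdx i) s = real (ival i s)"
| "rval \<rho>1 \<rho>2 Pi s = pi"
| "rval \<rho>1 \<rho>2 (Cell a i) s = snd s a (ival i s)"
| "rval \<rho>1 \<rho>2 (Add e f) s = rval \<rho>1 \<rho>2 e s + rval \<rho>1 \<rho>2 f s"
| "rval \<rho>1 \<rho>2 (Sub e f) s = rval \<rho>1 \<rho>2 e s - rval \<rho>1 \<rho>2 f s"
| "rval \<rho>1 \<rho>2 (Mul e f) s = rval \<rho>1 \<rho>2 e s * rval \<rho>1 \<rho>2 f s"
| "rval \<rho>1 \<rho>2 (Div e f) s = rval \<rho>1 \<rho>2 e s / rval \<rho>1 \<rho>2 f s"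
| "rval \<rho>1 \<rho>2 (Sqrt e) s = sqrt (rval \<rho>1 \<rho>2 e s)"
| "rval \<rho>1 \<rho>2 (Exp e) s = exp (rval \<rho>1 \<rho>2 e s)"
| "rval \<rho>1 \<rho>2 (Sin e) s = sin (rval \<rho>1 \<rho>2 e s)"
| "rval \<rho>1 \<rho>2 (Cos e) s = cos (rval \<rho>1 \<rho>2 e s)"
| "rval \<rho>1 \<rho>2 (Radius1 e) s = \<rho>1 (rval \<rho>1 \<rho>2 e s)"
| "rval \<rho>1 \<rho>2 (Radius2 e) s = \<rho>2 (rval \<rho>1 \<rho>2 e s)"

text \<open>\<open>exec \<rho>1 \<rho>2 c s t s'\<close>: started in state \<open>s\<close>, the command \<open>c\<close> terminates in state \<open>s'\<close> after \<open>t\<close>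
  steps. Every assignment and every test is one step; as the expressions occurring in a fixed
  program have bounded size, this agrees up to a constant factor, depending only on the program,
  with counting single operations.\<close>

inductive exec ::
  "(real \<Rightarrow> real) \<Rightarrow> (real \<Rightarrow> real) \<Rightarrow> com \<Rightarrow> state \<Rightarrow> nat \<Rightarrow> state \<Rightarrow> bool"
  for \<rho>1 \<rho>2 where
  Skip: "exec \<rho>1 \<rho>2 Skip s 1 s"
| ISet: "exec \<rho>1 \<rho>2 (ISet v i) s 1 ((fst s)(v := ival i s), snd s)"
| RSet: "exec \<rho>1 \<rho>2 (RSet a i e) s 1
           (fst s, (snd s)(a := (snd s a)(ival i s := rval \<rho>1 \<rho>2 e s)))"
| Seq: "\<lbrakk>exec \<rho>1 \<rho>2 c s t s'; exec \<rho>1 \<rho>2 d s' t' s''\<rbrakk>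
        \<Longrightarrow> exec \<rho>1 \<rho>2 (Seq c d) s (t + t') s''"
| IfTrue: "\<lbrakk>rval \<rho>1 \<rho>2 e s < rval \<rho>1 \<rho>2 f s; exec \<rho>1 \<rho>2 c s t s'\<rbrakk>
        \<Longrightarrow> exec \<rho>1 \<rho>2 (IfLess e f c d) s (1 + t) s'"
| IfFalse: "\<lbrakk>\<not> rval \<rho>1 \<rho>2 e s < rval \<rho>1 \<rho>2 f s; exec \<rho>1 \<rho>2 d s t s'\<rbrakk>
        \<Longrightarrow> exec \<rho>1 \<rho>2 (IfLess e f c d) s (1 + t) s'"
| WhileFalse: "\<not> rval \<rho>1 \<rho>2 e s < rval \<rho>1 \<rho>2 f s
        \<Longrightarrow> exec \<rho>1 \<rho>2 (WhileLess e f c) s 1 s"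
| WhileTrue: "\<lbrakk>rval \<rho>1 \<rho>2 e s < rval \<rho>1 \<rho>2 f s; exec \<rho>1 \<rho>2 c s t s';
         exec \<rho>1 \<rho>2 (WhileLess e f c) s' t' s''\<rbrakk>
        \<Longrightarrow> exec \<rho>1 \<rho>2 (WhileLess e f c) s (1 + t + t') s''"

inductive_cases SkipE: "exec \<rho>1 \<rho>2 Skip s t s'"
inductive_cases ISetE: "exec \<rho>1 \<rho>2 (ISet v i) s t s'"
inductive_cases RSetE: "exec \<rho>1 \<rho>2 (RSet a i e) s t s'"
inductive_cases SeqE: "exec \<rho>1 \<rho>2 (Seq c d) s t s'"
inductive_cases IfLessE: "exec \<rho>1 \<rho>2 (IfLess e f c d) s t s'"
inductive_cases WhileLessE: "exec \<rho>1 \<rho>2 (WhileLess e f c) s t s'"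

lemma exec_deterministic:
  "exec \<rho>1 \<rho>2 c s t s' \<Longrightarrow> exec \<rho>1 \<rho>2 c s u s'' \<Longrightarrow> u = t \<and> s'' = s'"
proof (induction arbitrary: u s'' rule: exec.induct)
  case (Skip s)
  then show ?case by (rule SkipE) simp
next
  case (ISet v i s)
  then show ?case by (rule ISetE) simp
next
  case (RSet a i e s)
  then show ?case by (rule RSetE) simp
next
  case (Seq c s t s' d t' s1)
  from Seq.prems show ?case by (rule SeqE) (use Seq.IH in metis)
next
  case (IfTrue e s f c t s' d)
  from IfTrue.prems show ?case by (rule IfLessE) (simp_all add: IfTrue.hyps IfTrue.IH)
next
  case (IfFalse e s f d t s' c)
  from IfFalse.prems show ?case by (rule IfLessE) (simp_all add: IfFalse.hyps IfFalse.IH)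
next
  case (WhileFalse e s f c)
  from WhileFalse.prems show ?case by (rule WhileLessE) (simp_all add: WhileFalse.hyps)
next
  case (WhileTrue e s f c t s' t' s1)
  from WhileTrue.prems show ?case
  proof (rule WhileLessE)
    fix v r v'
    assume u: "u = Suc (v + v')" and body: "exec \<rho>1 \<rho>2 c s v r"
      and rest: "exec \<rho>1 \<rho>2 (WhileLess e f c) r v' s''"
    have "v = t" "r = s'" using WhileTrue.IH(1)[OF body] by auto
    with WhileTrue.IH(2)[of v' s''] rest u show ?thesis by simp
  qed (simp_all add: WhileTrue.hyps)
qed

text \<open>The parameters \<open>\<eta>\<close> and \<open>\<epsilon>\<close> are passed in cells 0 and 1 of array 0, all other memory is
  initially zero, and the result is read from cell 0 of array 0.\<close>

definition init_state :: "real \<Rightarrow> real \<Rightarrow> state" where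
  "init_state \<eta> \<epsilon> = ((\<lambda>_. 0), (\<lambda>_ _. 0)(0 := (\<lambda>_. 0)(0 := \<eta>, 1 := \<epsilon>)))"

definition outputs_in_time ::
  "com \<Rightarrow> real \<Rightarrow> real \<Rightarrow> (real^2) set \<Rightarrow> (real^2) set \<Rightarrow> real \<Rightarrow> nat \<Rightarrow> bool" where
  "outputs_in_time P \<eta> \<epsilon> X1 X2 D t \<longleftrightarrow>
     (\<exists>s'. exec (radius X1) (radius X2) P (init_state \<eta> \<epsilon>) t s' \<and> D = snd s' 0 0)"

end

theory Submission
  imports Defs
begin

text \<open>Since \<open>\<Phi> (x - y) = exp (- x) * exp y\<close>, the sketch of a shape with radius function \<open>\<rho>\<close> is the
  correlation of the two Lipschitz functions \<open>exp (- \<rho>)\<close> and \<open>exp \<rho>\<close>. Although these are only Lipschitz,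
  their correlation gains a derivative: its second differences with step \<open>h\<close> are \<open>O(h\<^sup>2)\<close>. Hence
  interpolating it linearly between the \<open>N\<close> multiples of \<open>2\<pi>/N\<close> costs only an error \<open>O(1/N\<^sup>2)\<close>. At such
  a grid point, replacing both factors by their means over the \<open>N\<close> blocks of length \<open>2\<pi>/N\<close> costs a
  covariance, which is again \<open>O(1/N\<^sup>2)\<close>, and the block means themselves are obtained to this accuracy
  from \<open>N\<close> samples per block. So \<open>N\<close> of order \<open>1/\<surd>\<epsilon>\<close> suffices, and even the naive evaluation of all
  correlation sums takes only \<open>O(N\<^sup>2) = O(1/\<epsilon>)\<close> steps; no fast Fourier transform is needed.\<close>

section \<open>Quadrature and interpolation\<close>

text \<open>For u \<le> v \<le> c factor out \<open>exp v\<close>: what remains,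
  \<open>1 - exp (u - v)\<close>, is at most v - u by the tangent inequality 1 + x \<le> exp
  x.\<close>

lemma abs_exp_diff_le:
  fixes x y :: real
  assumes "x \<le> c" "y \<le> c"
  shows "\<bar>exp x - exp y\<bar> \<le> exp c * \<bar>x - y\<bar>"
proof -
  have *: "exp v - exp u \<le> exp c * (v - u)" if "u \<le> v" "v \<le> c" for u v :: real
  proof -
    have "exp v * (1 - exp (u - v)) \<le> exp c * (v - u)"
    proof (intro mult_mono)
      show "1 - exp (u - v) \<le> v - u"
        using exp_ge_add_one_self[of "u - v"] by linarith
    qed (use that in auto)
    then show ?thesis by (simp add: algebra_simps flip: exp_add)
  qed
  show ?thesis
    using *[of x y] *[of y x] assms by (cases "x \<le> y") (auto simp: abs_if)
qed

lemma has_integral_blocks: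
  fixes f :: "real \<Rightarrow> real"
  assumes "0 \<le> \<delta>"
    and "\<And>k. k < n \<Longrightarrow> (f has_integral J k) {real k * \<delta>..real (Suc k) * \<delta>}"
  shows "(f has_integral (\<Sum>k<n. J k)) {0..real n * \<delta>}"
  using assms(2)
proof (induction n)
  case (Suc n)
  have "(f has_integral (\<Sum>k<n. J k) + J n) {0..real (Suc n) * \<delta>}"
    using Suc assms(1)
    by (intro has_integral_combine[where c = "real n * \<delta>" and a = 0]) (auto simp: mult_right_mono)
  then show ?case by simp
qed auto

text \<open>Only first order in the step, since a Lipschitz integrand allows no more. It is applied
  with M = N^2 points, which is what turns it into an error of order 1/N^2.\<close>

lemma left_riemann_sum_error:
  fixes f :: "real \<Rightarrow> real"
  assumes M: "0 < M" and lip: "L-lipschitz_on UNIV f"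
  shows "\<bar>1 / (2 * pi) * integral {0..2 * pi} f - (\<Sum>i<M. f (2 * pi * real i / real M)) / real M\<bar>
           \<le> L * (2 * pi / real M)"
proof -
  define \<delta> where "\<delta> = 2 * pi / real M"
  have \<delta>: "0 < \<delta>" "real M * \<delta> = 2 * pi" using M by (auto simp: \<delta>_def)
  have L: "0 \<le> L" using lip lipschitz_on_nonneg by blast
  have cont: "continuous_on A f" for A
    using lipschitz_on_continuous_on[OF lip] continuous_on_subset by blast
  let ?J = "\<lambda>k. integral {real k * \<delta>..real (Suc k) * \<delta>} f"
  have "(f has_integral (\<Sum>k<M. ?J k)) {0..real M * \<delta>}"
    using \<delta> by (intro has_integral_blocks integrable_integral integrable_continuous_real cont) auto
  then have total: "integral {0..2 * pi} f = (\<Sum>k<M. ?J k)"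
    using \<delta> by (metis integral_unique)
  have block: "\<bar>?J k - \<delta> * f (real k * \<delta>)\<bar> \<le> L * \<delta> * \<delta>" for k
  proof -
    have "((\<lambda>x. f x - f (real k * \<delta>)) has_integral
        (?J k - (real (Suc k) * \<delta> - real k * \<delta>) *\<^sub>R f (real k * \<delta>))) {real k * \<delta>..real (Suc k) * \<delta>}"
      using \<delta> by (intro has_integral_diff integrable_integral integrable_continuous_real cont
          has_integral_const_real[where a = "real k * \<delta>" and b = "real (Suc k) * \<delta>", THEN has_integral_eq_rhs])
        (auto simp: algebra_simps)
    moreover have "norm (f x - f (real k * \<delta>)) \<le> L * \<delta>"
      if "x \<in> {real k * \<delta>..real (Suc k) * \<delta>}" for x
    proof -
      have "norm (f x - f (real k * \<delta>)) \<le> L * dist x (real k * \<delta>)"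
        using lipschitz_onD[OF lip, of x "real k * \<delta>"] by (simp add: dist_norm)
      also have "\<dots> \<le> L * \<delta>"
        using that L by (intro mult_left_mono) (auto simp: dist_real_def algebra_simps)
      finally show ?thesis .
    qed
    ultimately have "norm (?J k - (real (Suc k) * \<delta> - real k * \<delta>) *\<^sub>R f (real k * \<delta>))
        \<le> L * \<delta> * measure lborel {real k * \<delta>..real (Suc k) * \<delta>}"
      using L \<delta> by (intro has_integral_bound_real[where S="{}"]) auto
    then show ?thesis using \<delta> by (simp add: algebra_simps)
  qed
  have "\<bar>(\<Sum>k<M. ?J k) - \<delta> * (\<Sum>i<M. f (real i * \<delta>))\<bar> \<le> (\<Sum>k<M. \<bar>?J k - \<delta> * f (real k * \<delta>)\<bar>)"
    by (simp add: sum_distrib_left flip: sum_subtractf)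
  also have "\<dots> \<le> (\<Sum>k<M. L * \<delta> * \<delta>)" by (intro sum_mono block)
  also have "\<dots> = L * \<delta> * (2 * pi)" using \<delta>(2) by simp
  finally have "\<bar>integral {0..2 * pi} f - \<delta> * (\<Sum>i<M. f (real i * \<delta>))\<bar> / (2 * pi) \<le> L * \<delta>"
    unfolding total by (simp add: field_simps)
  moreover have "\<bar>1 / (2 * pi) * integral {0..2 * pi} f - (\<Sum>i<M. f (2 * pi * real i / real M)) / real M\<bar>
    = \<bar>(integral {0..2 * pi} f - \<delta> * (\<Sum>i<M. f (real i * \<delta>))) / (2 * pi)\<bar>"
    using M by (auto simp: \<delta>_def field_simps)
  ultimately show ?thesis
    by (simp add: \<delta>_def)
qed

text \<open>The difference is a covariance, that is, the mean of the products of the deviations from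
  the two means. Each deviation is itself an average of pairwise differences and so inherits the
  bound p or q. The product of two small oscillations is where the second order in 1/N comes
  from.\<close>

lemma covariance_bound:
  fixes x y :: "nat \<Rightarrow> real"
  assumes N: "0 < N"
    and x: "\<And>i j. i < N \<Longrightarrow> j < N \<Longrightarrow> \<bar>x i - x j\<bar> \<le> p"
    and y: "\<And>i j. i < N \<Longrightarrow> j < N \<Longrightarrow> \<bar>y i - y j\<bar> \<le> q"
  shows "\<bar>(\<Sum>i<N. x i * y i / N) - (\<Sum>i<N. x i / N) * (\<Sum>i<N. y i / N)\<bar> \<le> p * q"
proof -
  have dev: "\<bar>z i - (\<Sum>j<N. z j / N)\<bar> \<le> r"
    if "i < N" "\<And>i j. i < N \<Longrightarrow> j < N \<Longrightarrow> \<bar>z i - z j\<bar> \<le> r" for z :: "nat \<Rightarrow> real" and r i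
  proof -
    have "z i - (\<Sum>j<N. z j / N) = (\<Sum>j<N. (z i - z j) / N)"
      using N by (simp add: diff_divide_distrib sum_subtractf)
    also have "\<bar>\<dots>\<bar> \<le> (\<Sum>j<N. r / N)"
      using that by (intro order_trans[OF sum_abs] sum_mono) (auto simp: divide_right_mono)
    finally show ?thesis using N by simp
  qed
  define X where "X = (\<Sum>i<N. x i / N)"
  define Y where "Y = (\<Sum>i<N. y i / N)"
  have "(\<Sum>i<N. x i * y i / N) - X * Y = (\<Sum>i<N. (x i - X) * (y i - Y) / N)"
  proof -
    have "(\<Sum>i<N. (x i - X) * (y i - Y) / N)
        = (\<Sum>i<N. x i * y i / N - X * (y i / N) - Y * (x i / N) + X * Y / N)"
      by (intro sum.cong refl) (simp add: diff_divide_distrib add_divide_distrib algebra_simps)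
    also have "\<dots> = (\<Sum>i<N. x i * y i / N) - X * Y - Y * X + X * Y"
    proof -
      have "(\<Sum>i<N. X * (y i / N)) = X * Y" "(\<Sum>i<N. Y * (x i / N)) = Y * X"
        unfolding X_def Y_def by (simp_all only: sum_distrib_left)
      then show ?thesis
        using N by (simp add: sum.distrib sum_subtractf)
    qed
    finally show ?thesis by simp
  qed
  also have "\<bar>\<dots>\<bar> \<le> (\<Sum>i<N. p * q / N)"
  proof (intro order_trans[OF sum_abs] sum_mono)
    fix i assume "i \<in> {..<N}"
    then have "\<bar>x i - X\<bar> \<le> p" "\<bar>y i - Y\<bar> \<le> q"
      using dev x y unfolding X_def Y_def by auto
    then have "\<bar>x i - X\<bar> * \<bar>y i - Y\<bar> \<le> p * q"
      by (intro mult_mono) auto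
    then show "\<bar>(x i - X) * (y i - Y) / N\<bar> \<le> p * q / N"
      by (simp add: abs_mult divide_right_mono)
  qed
  finally show ?thesis using N by (simp add: X_def Y_def)
qed

text \<open>Where the modulus of the interpolation error \<open>e\<close> is maximal, take \<open>h\<close> to be the distance to the
  nearer end point: one of the outer values in the second difference of \<open>e\<close> then vanishes and the
  other is at most the maximum.\<close>

lemma linear_interpolation_error:
  fixes f :: "real \<Rightarrow> real"
  assumes \<delta>: "0 \<le> \<delta>" and K: "0 \<le> K" and cont: "continuous_on {u..u + \<delta>} f"
    and diff2: "\<And>x h. 0 \<le> h \<Longrightarrow> h \<le> \<delta> / 2 \<Longrightarrow> \<bar>f (x + h) - 2 * f x + f (x - h)\<bar> \<le> K * h\<^sup>2"
    and x: "0 \<le> x" "x \<le> \<delta>"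
  shows "\<bar>f (u + x) - (f u + x / \<delta> * (f (u + \<delta>) - f u))\<bar> \<le> K * \<delta>\<^sup>2 / 4"
proof (cases "\<delta> = 0")
  case False
  define e where "e = (\<lambda>x. f (u + x) - (f u + x / \<delta> * (f (u + \<delta>) - f u)))"
  have "continuous_on {0..\<delta>} (\<lambda>x. \<bar>e x\<bar>)"
    unfolding e_def using False
    by (intro continuous_intros continuous_on_compose2[OF cont]) auto
  then obtain c where c: "c \<in> {0..\<delta>}" and max: "\<And>y. y \<in> {0..\<delta>} \<Longrightarrow> \<bar>e y\<bar> \<le> \<bar>e c\<bar>"
    using continuous_attains_sup[of "{0..\<delta>}" "\<lambda>x. \<bar>e x\<bar>"] \<delta> by auto
  define h where "h = min c (\<delta> - c)"
  have h: "0 \<le> h" "h \<le> \<delta> / 2" using c by (auto simp: h_def min_def)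
  have ends: "e 0 = 0" "e \<delta> = 0" using False by (auto simp: e_def)
  have "e (c + h) - 2 * e c + e (c - h) = f (u + c + h) - 2 * f (u + c) + f (u + c - h)"
    using False by (simp add: e_def field_simps)
  then have "\<bar>e (c + h) - 2 * e c + e (c - h)\<bar> \<le> K * h\<^sup>2"
    using diff2[OF h] by simp
  moreover have "\<bar>e (c + h) + e (c - h)\<bar> \<le> \<bar>e c\<bar>"
    using c ends max[of "c + h"] max[of "c - h"] by (auto simp: h_def min_def split: if_splits)
  ultimately have "\<bar>e c\<bar> \<le> K * h\<^sup>2" by linarith
  also have "\<dots> \<le> K * (\<delta> / 2)\<^sup>2" using h K by (intro mult_left_mono power_mono) auto
  finally show ?thesis using max[of x] x by (simp add: e_def power2_eq_square)
qed (use x in auto)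

lemma integral_periodic_shift:
  fixes f :: "real \<Rightarrow> real"
  assumes cont: "continuous_on UNIV f" and per: "\<And>x. f (x + p) = f x" and h: "0 \<le> h" "h \<le> p"
  shows "integral {0..p} (\<lambda>x. f (x + h)) = integral {0..p} f"
proof -
  have int: "f integrable_on {a..b}" for a b
    using cont by (intro integrable_continuous_real) (auto intro: continuous_on_subset)
  have shift: "integral {a..b} (\<lambda>x. f (x + c)) = integral {a + c..b + c} f" for a b c
    using integral_shift[of a c b f] cont by (auto simp: o_def intro: continuous_on_subset)
  have "integral {0..p} (\<lambda>x. f (x + h)) = integral {h..p + h} f"
    by (simp add: shift)
  also have "\<dots> = integral {h..p} f + integral {0 + p..h + p} f"
    using Henstock_Kurzweil_Integration.integral_combine[where a = h and c = p and b = "p + h" and f = f]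
      h int by (simp add: add.commute)
  also have "integral {0 + p..h + p} f = integral {0..h} f"
    using shift[of 0 h p] per by simp
  also have "integral {h..p} f + integral {0..h} f = integral {0..p} f"
    using Henstock_Kurzweil_Integration.integral_combine[where a = 0 and c = h and b = p and f = f]
      h int by simp
  finally show ?thesis .
qed

section \<open>Mean-square norms of nearby and of piecewise linear functions\<close>

lemma L2_norm_diff_le:
  fixes f g :: "real \<Rightarrow> real"
  assumes ab: "a < b" and cont: "continuous_on {a..b} f" "continuous_on {a..b} g"
    and e: "\<And>x. x \<in> {a..b} \<Longrightarrow> \<bar>f x - g x\<bar> \<le> e"
  shows "\<bar>sqrt (integral {a..b} (\<lambda>x. (f x)\<^sup>2)) - sqrt (integral {a..b} (\<lambda>x. (g x)\<^sup>2))\<bar>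
           \<le> e * sqrt (b - a)"
proof -
  \<comment> \<open>One direction of the triangle inequality: integrate (|g| + e)^2 and bound the
    cross term by Cauchy-Schwarz against the constant 1, which completes the square.\<close>
  have *: "sqrt (integral {a..b} (\<lambda>x. (f x)\<^sup>2)) \<le> sqrt (integral {a..b} (\<lambda>x. (g x)\<^sup>2)) + e * sqrt (b - a)"
    if cont: "continuous_on {a..b} f" "continuous_on {a..b} g"
      and e: "\<And>x. x \<in> {a..b} \<Longrightarrow> \<bar>f x - g x\<bar> \<le> e" for f g :: "real \<Rightarrow> real"
  proof -
    let ?G = "integral {a..b} (\<lambda>x. (g x)\<^sup>2)" and ?A = "integral {a..b} (\<lambda>x. \<bar>g x\<bar>)"
    have e0: "0 \<le> e" using e[of a] ab by auto
    have hg2: "((\<lambda>x. (g x)\<^sup>2) has_integral ?G) {a..b}"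
      and hg: "((\<lambda>x. \<bar>g x\<bar>) has_integral ?A) {a..b}"
      by (intro integrable_integral integrable_continuous_real continuous_intros cont)+
    have hc: "((\<lambda>x. c) has_integral c * (b - a)) {a..b}" for c :: real
      using has_integral_const_real[of c a b] ab by (simp add: mult.commute)
    have G0: "0 \<le> ?G" by (rule has_integral_nonneg[OF hg2]) auto
    have A: "?A \<le> sqrt ?G * sqrt (b - a)"
    proof -
      \<comment> \<open>Cauchy-Schwarz by taking m to be the mean of |g|: integrating (|g| - m)^2
        \<ge> 0 with this optimal m leaves exactly the required inequality.\<close>
      define m where "m = ?A / (b - a)"
      have "((\<lambda>x. (g x)\<^sup>2 - 2 * m * \<bar>g x\<bar> + m\<^sup>2) has_integral (?G - 2 * m * ?A + m\<^sup>2 * (b - a))) {a..b}"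
        by (intro has_integral_add has_integral_diff has_integral_mult_right hg hg2 hc)
      then have "0 \<le> ?G - 2 * m * ?A + m\<^sup>2 * (b - a)"
      proof (rule has_integral_nonneg)
        fix x show "0 \<le> (g x)\<^sup>2 - 2 * m * \<bar>g x\<bar> + m\<^sup>2"
          using zero_le_power2[of "\<bar>g x\<bar> - m"] by (simp add: power2_diff algebra_simps)
      qed
      also have "\<dots> = ?G - ?A\<^sup>2 / (b - a)"
      proof -
        have "m * (b - a) = ?A" using ab by (simp add: m_def)
        then have "m\<^sup>2 * (b - a) = m * ?A" by (simp add: power2_eq_square mult.assoc)
        moreover have "m * ?A = ?A\<^sup>2 / (b - a)" by (simp add: m_def power2_eq_square)
        ultimately show ?thesis by simp
      qed
      finally have "?A\<^sup>2 \<le> ?G * (b - a)" using ab by (simp add: field_simps)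
      then show ?thesis
        by (metis real_le_rsqrt real_sqrt_mult)
    qed
    have "((\<lambda>x. (f x)\<^sup>2) has_integral integral {a..b} (\<lambda>x. (f x)\<^sup>2)) {a..b}"
      by (intro integrable_integral integrable_continuous_real continuous_intros cont)
    moreover have "((\<lambda>x. (g x)\<^sup>2 + 2 * e * \<bar>g x\<bar> + e\<^sup>2) has_integral (?G + 2 * e * ?A + e\<^sup>2 * (b - a))) {a..b}"
      by (intro has_integral_add has_integral_mult_right hg hg2 hc)
    ultimately have "integral {a..b} (\<lambda>x. (f x)\<^sup>2) \<le> ?G + 2 * e * ?A + e\<^sup>2 * (b - a)"
    proof (rule has_integral_le)
      fix x assume "x \<in> {a..b}"
      then have "\<bar>f x\<bar> \<le> \<bar>g x\<bar> + e" using e by fastforce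
      then have "\<bar>f x\<bar>\<^sup>2 \<le> (\<bar>g x\<bar> + e)\<^sup>2" by (intro power_mono) auto
      then show "(f x)\<^sup>2 \<le> (g x)\<^sup>2 + 2 * e * \<bar>g x\<bar> + e\<^sup>2"
        by (simp add: power2_sum algebra_simps)
    qed
    also have "\<dots> \<le> ?G + 2 * e * (sqrt ?G * sqrt (b - a)) + e\<^sup>2 * (b - a)"
      using A e0 by (intro add_mono mult_left_mono order_refl) auto
    also have "\<dots> = (sqrt ?G + e * sqrt (b - a))\<^sup>2"
      using G0 ab by (simp add: power2_sum power_mult_distrib algebra_simps)
    finally show ?thesis using G0 ab e0 by (intro real_le_lsqrt) auto
  qed
  show ?thesis
    using *[OF cont] *[OF cont(2) cont(1)] e by (fastforce simp: abs_le_iff abs_minus_commute)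
qed

lemma sum_rectangle:
  fixes F :: "nat \<Rightarrow> 'a::comm_monoid_add"
  shows "(\<Sum>i<M * N. F i) = (\<Sum>j<M. \<Sum>i<N. F (j * N + i))"
proof (induction M)
  case (Suc M)
  have "(\<Sum>i<Suc M * N. F i) = (\<Sum>i<M * N. F i) + (\<Sum>i<N. F (M * N + i))"
    using sum.nat_group[of F N "Suc M"] sum.nat_group[of F N M]
      sum.shift_bounds_nat_ivl[of F 0 "M * N" N]
    by (simp add: add.commute atLeast0LessThan)
  then show ?case using Suc by simp
qed simp

lemma average_bound:
  fixes f :: "real \<Rightarrow> real"
  assumes "f integrable_on {0..2 * pi}" "\<And>x. \<bar>f x\<bar> \<le> B"
  shows "\<bar>1 / (2 * pi) * integral {0..2 * pi} f\<bar> \<le> B"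
proof -
  have "norm (integral {0..2 * pi} f) \<le> B * measure lborel {0..2 * pi}"
    using order_trans[OF abs_ge_zero assms(2)[of 0]] assms
    by (intro has_integral_bound_real[where S="{}" and f = f] integrable_integral) auto
  then show ?thesis by (simp add: field_simps abs_mult)
qed

text \<open>An exact value, so that the norm of the piecewise linear interpolant is computable from
  the node values in constant time per interval and without further error.\<close>

lemma integral_linear_square:
  fixes p q \<delta> u :: real
  assumes \<delta>: "0 < \<delta>"
  shows "integral {u..u + \<delta>} (\<lambda>x. (p + (x - u) / \<delta> * (q - p))\<^sup>2) = \<delta> * (p\<^sup>2 + p * q + q\<^sup>2) / 3"
proof -
  let ?F = "\<lambda>x. p\<^sup>2 * (x - u) + p * (q - p) / \<delta> * (x - u)\<^sup>2 + (q - p)\<^sup>2 / (3 * \<delta>\<^sup>2) * (x - u)^3"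
  have "((\<lambda>x. (p + (x - u) / \<delta> * (q - p))\<^sup>2) has_integral ?F (u + \<delta>) - ?F u) {u..u + \<delta>}"
  proof (intro fundamental_theorem_of_calculus)
    fix x
    show "(?F has_vector_derivative (p + (x - u) / \<delta> * (q - p))\<^sup>2) (at x within {u..u + \<delta>})"
      unfolding has_real_derivative_iff_has_vector_derivative[symmetric]
      using \<delta> by (auto intro!: derivative_eq_intros simp: field_simps power2_eq_square)
  qed (use \<delta> in auto)
  moreover have "?F (u + \<delta>) - ?F u = \<delta> * (p\<^sup>2 + p * q + q\<^sup>2) / 3"
    using \<delta> by (simp add: field_simps power2_eq_square power3_eq_cube)
  ultimately show ?thesis by (metis integral_unique)
qed

text \<open>The affine pieces are never glued into one function. On each block
  \<open>L2_norm_diff_le\<close> compares the norm of f with that of its affine piece; the block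
  norms are then regarded as two vectors in N-dimensional Euclidean space, to which the finite
  triangle inequality applies.\<close>

lemma L2_norm_piecewise_linear_error:
  fixes f :: "real \<Rightarrow> real" and c :: "nat \<Rightarrow> real"
  assumes N: "0 < N" and cont: "\<And>A. continuous_on A f"
    and err: "\<And>k x. 0 \<le> x \<Longrightarrow> x \<le> 2 * pi / real N \<Longrightarrow>
      \<bar>f (2 * pi * real k / real N + x) - (c k + x / (2 * pi / real N) * (c (Suc k) - c k))\<bar> \<le> e"
  shows "\<bar>sqrt (\<Sum>k<N. ((c k)\<^sup>2 + c k * c (Suc k) + (c (Suc k))\<^sup>2) / (3 * real N))
           - sqrt (1 / (2 * pi) * integral {0..2 * pi} (\<lambda>x. (f x)\<^sup>2))\<bar> \<le> e"
proof -
  define \<delta> where "\<delta> = 2 * pi / real N"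
  have \<delta>: "0 < \<delta>" "real N * \<delta> = 2 * pi" using N by (auto simp: \<delta>_def)
  define u where "u = (\<lambda>k::nat. real k * \<delta>)"
  have u_Suc: "u (Suc k) = u k + \<delta>" for k by (simp add: u_def algebra_simps)
  define g where "g = (\<lambda>k x. c k + (x - u k) / \<delta> * (c (Suc k) - c k))"
  define I where "I = (\<lambda>k. integral {u k..u k + \<delta>} (\<lambda>x. (f x)\<^sup>2))"
  define J where "J = (\<lambda>k. integral {u k..u k + \<delta>} (\<lambda>x. (g k x)\<^sup>2))"
  have cont_g: "continuous_on A (g k)" for A k
    unfolding g_def using \<delta> by (intro continuous_intros) auto
  have e0: "0 \<le> e" using err[of 0 0] N by (auto intro: order_trans[OF abs_ge_zero])
  have block: "\<bar>sqrt (J k) - sqrt (I k)\<bar> \<le> e * sqrt \<delta>" for k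
  proof -
    have "\<bar>sqrt (I k) - sqrt (J k)\<bar> \<le> e * sqrt (u k + \<delta> - u k)"
      unfolding I_def J_def
    proof (intro L2_norm_diff_le cont)
      show "continuous_on {u k..u k + \<delta>} (g k)" by (rule cont_g)
      fix x assume "x \<in> {u k..u k + \<delta>}"
      then show "\<bar>f x - g k x\<bar> \<le> e"
        using err[of "x - u k" k] by (simp add: g_def u_def \<delta>_def mult.commute)
    qed (use \<delta> in auto)
    then show ?thesis by (simp add: abs_minus_commute)
  qed
  have "((\<lambda>x. (f x)\<^sup>2) has_integral (\<Sum>k<N. I k)) {0..real N * \<delta>}"
  proof (intro has_integral_blocks)
    fix k
    show "((\<lambda>x. (f x)\<^sup>2) has_integral I k) {real k * \<delta>..real (Suc k) * \<delta>}"
      unfolding I_def u_Suc[symmetric] unfolding u_def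
      by (intro integrable_integral integrable_continuous_real continuous_intros cont)
  qed (use \<delta> in auto)
  then have I_total: "integral {0..2 * pi} (\<lambda>x. (f x)\<^sup>2) = (\<Sum>k<N. I k)"
    using \<delta> by (metis integral_unique)
  have J_eq: "J k = \<delta> * ((c k)\<^sup>2 + c k * c (Suc k) + (c (Suc k))\<^sup>2) / 3" for k
    unfolding J_def g_def by (rule integral_linear_square) (rule \<delta>)
  have I0: "0 \<le> I k" and J0: "0 \<le> J k" for k
    unfolding I_def J_def
    by (intro integral_nonneg integrable_continuous_real continuous_intros cont cont_g zero_le_power2)+
  have sqrt_I: "sqrt (\<Sum>k<N. I k) = L2_set (\<lambda>k. sqrt (I k)) {..<N}"
    and sqrt_J: "sqrt (\<Sum>k<N. J k) = L2_set (\<lambda>k. sqrt (J k)) {..<N}"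
    by (simp_all add: L2_set_def I0 J0)
  \<comment> \<open>N coordinates, each off by at most \<open>e * sqrt \<delta>\<close>, give a
    vector of norm at most \<open>e * sqrt (2 * pi)\<close> because N \<delta> = 2 pi. The
    normalisation by 2 pi later removes this factor.\<close>
  have one_sided: "L2_set x {..<N} \<le> L2_set y {..<N} + e * sqrt (2 * pi)"
    if "\<And>k. \<bar>x k - y k\<bar> \<le> e * sqrt \<delta>" for x y :: "nat \<Rightarrow> real"
  proof -
    have "(\<Sum>k<N. (x k - y k)\<^sup>2) \<le> (\<Sum>k<N. (e * sqrt \<delta>)\<^sup>2)"
      using that by (intro sum_mono) (metis abs_ge_zero power2_abs power_mono)
    also have "\<dots> = (e * sqrt (2 * pi))\<^sup>2"
      using \<delta> by (simp add: power_mult_distrib algebra_simps)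
    finally have "L2_set (\<lambda>k. x k - y k) {..<N} \<le> e * sqrt (2 * pi)"
      unfolding L2_set_def using e0 by (intro real_le_lsqrt) auto
    then show ?thesis
      using L2_set_triangle_ineq[of y "\<lambda>k. x k - y k" "{..<N}"] by simp
  qed
  have "\<bar>sqrt (\<Sum>k<N. J k) - sqrt (\<Sum>k<N. I k)\<bar> \<le> e * sqrt (2 * pi)"
    unfolding sqrt_I sqrt_J
    using one_sided[of "\<lambda>k. sqrt (I k)" "\<lambda>k. sqrt (J k)"] one_sided[of "\<lambda>k. sqrt (J k)" "\<lambda>k. sqrt (I k)"] block
    by (simp add: abs_le_iff)
  then have "\<bar>sqrt (\<Sum>k<N. J k) - sqrt (\<Sum>k<N. I k)\<bar> / sqrt (2 * pi) \<le> e"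
    by (simp add: field_simps)
  moreover have "sqrt (1 / (2 * pi) * integral {0..2 * pi} (\<lambda>x. (f x)\<^sup>2)) = sqrt (\<Sum>k<N. I k) / sqrt (2 * pi)"
    by (simp add: I_total real_sqrt_divide)
  moreover have "sqrt (\<Sum>k<N. ((c k)\<^sup>2 + c k * c (Suc k) + (c (Suc k))\<^sup>2) / (3 * real N)) = sqrt (\<Sum>k<N. J k) / sqrt (2 * pi)"
  proof -
    have "(\<Sum>k<N. ((c k)\<^sup>2 + c k * c (Suc k) + (c (Suc k))\<^sup>2) / (3 * real N)) = (\<Sum>k<N. J k / (2 * pi))"
      using N by (intro sum.cong refl) (simp add: J_eq \<delta>_def field_simps)
    then show ?thesis by (simp add: real_sqrt_divide flip: sum_divide_distrib)
  qed
  ultimately show ?thesis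
    by (simp add: abs_divide flip: diff_divide_distrib)
qed


section \<open>Correlations of Lipschitz functions\<close>

text \<open>A mean over finitely many samples instead of an integral mean, so that a program can
  compute it exactly. The samples of all blocks together form one uniform grid of step 2 pi /
  N^2.\<close>

definition block_mean :: "(real \<Rightarrow> real) \<Rightarrow> nat \<Rightarrow> nat \<Rightarrow> real" where
  "block_mean f N j = (\<Sum>i<N. f (2 * pi * (real j + real i / real N) / real N) / real N)"

text \<open>The interface between geometry and analysis: the facts about a radius function on which
  all error estimates rest. \<open>lipschitz_profile_radius\<close> supplies them for star
  shapes.\<close>

locale lipschitz_profile =
  fixes \<rho> :: "real \<Rightarrow> real" and \<eta> :: real
  assumes eta_nonneg: "0 \<le> \<eta>"
    and periodic: "\<rho> (\<theta> + 2 * pi) = \<rho> \<theta>"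
    and nonneg: "0 \<le> \<rho> \<theta>"
    and le_one: "\<rho> \<theta> \<le> 1"
    and lip: "\<bar>\<rho> \<theta> - \<rho> \<theta>'\<bar> \<le> \<eta> / (2 * pi) * \<bar>\<theta> - \<theta>'\<bar>"
begin

definition "decay \<theta> = exp (- \<rho> \<theta>)"
definition "growth \<theta> = exp (\<rho> \<theta>)"
text \<open>With \<Phi> z = exp (- z) this is the sketch itself, its integrand split into a factor
  at \<theta> and a factor at \<theta> + \<alpha>. \<open>node_corr N k\<close> is its computable
  substitute at the angle 2 pi k / N.\<close>

definition "corr \<alpha> = 1 / (2 * pi) * integral {0..2 * pi} (\<lambda>\<theta>. decay \<theta> * growth (\<theta> + \<alpha>))"
definition "node_corr N k = (\<Sum>j<N. block_mean decay N j * block_mean growth N (j + k) / real N)"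

lemma decay_lip: "\<bar>decay x - decay y\<bar> \<le> \<eta> / (2 * pi) * \<bar>x - y\<bar>"
  using abs_exp_diff_le[of "- \<rho> x" 0 "- \<rho> y"] nonneg[of x] nonneg[of y] lip[of x y]
  by (simp add: decay_def abs_minus_commute)

lemma growth_lip: "\<bar>growth x - growth y\<bar> \<le> exp 1 * (\<eta> / (2 * pi)) * \<bar>x - y\<bar>"
proof -
  have "\<bar>growth x - growth y\<bar> \<le> exp 1 * \<bar>\<rho> x - \<rho> y\<bar>"
    unfolding growth_def by (intro abs_exp_diff_le le_one)
  also have "\<dots> \<le> exp 1 * (\<eta> / (2 * pi) * \<bar>x - y\<bar>)"
    by (intro mult_left_mono lip) auto
  finally show ?thesis by (simp add: mult.assoc)
qed

lemma cont_profile: "continuous_on A \<rho>"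
proof -
  have "(\<eta> / (2 * pi))-lipschitz_on A \<rho>"
    using lip eta_nonneg by (intro lipschitz_onI) (auto simp: dist_real_def)
  then show ?thesis by (rule lipschitz_on_continuous_on)
qed

lemma cont_decay: "continuous_on A decay"
  unfolding decay_def by (intro continuous_intros cont_profile)

lemma cont_growth: "continuous_on A (\<lambda>\<theta>. growth (\<theta> + \<alpha>))"
  unfolding growth_def
  by (intro continuous_intros continuous_on_compose2[OF cont_profile[of UNIV]]) auto

lemma corr_integrable: "(\<lambda>\<theta>. decay \<theta> * growth (\<theta> + \<alpha>)) integrable_on {a..b}"
  by (intro integrable_continuous_real continuous_intros cont_decay cont_growth)

lemma decay_le_one: "\<bar>decay \<theta>\<bar> \<le> 1"
  using nonneg by (simp add: decay_def)

section \<open>Regularity of the correlation function\<close>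

lemma corr_lip: "\<bar>corr \<alpha> - corr \<beta>\<bar> \<le> exp 1 * (\<eta> / (2 * pi)) * \<bar>\<alpha> - \<beta>\<bar>"
proof -
  let ?f = "\<lambda>\<theta>. decay \<theta> * growth (\<theta> + \<alpha>) - decay \<theta> * growth (\<theta> + \<beta>)"
  have "\<bar>1 / (2 * pi) * integral {0..2 * pi} ?f\<bar> \<le> exp 1 * (\<eta> / (2 * pi)) * \<bar>\<alpha> - \<beta>\<bar>"
  proof (rule average_bound)
    show "?f integrable_on {0..2 * pi}" by (intro integrable_diff corr_integrable)
    fix \<theta>
    have "\<bar>?f \<theta>\<bar> = \<bar>decay \<theta>\<bar> * \<bar>growth (\<theta> + \<alpha>) - growth (\<theta> + \<beta>)\<bar>"
      by (simp add: right_diff_distrib flip: abs_mult)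
    also have "\<dots> \<le> 1 * (exp 1 * (\<eta> / (2 * pi)) * \<bar>\<alpha> - \<beta>\<bar>)"
      using growth_lip[of "\<theta> + \<alpha>" "\<theta> + \<beta>"] by (intro mult_mono decay_le_one) auto
    finally show "\<bar>?f \<theta>\<bar> \<le> exp 1 * (\<eta> / (2 * pi)) * \<bar>\<alpha> - \<beta>\<bar>" by simp
  qed
  then show ?thesis
    by (simp add: corr_def integral_diff corr_integrable right_diff_distrib)
qed

lemma cont_corr: "continuous_on A corr"
proof -
  have "(exp 1 * (\<eta> / (2 * pi)))-lipschitz_on A corr"
    using corr_lip eta_nonneg by (intro lipschitz_onI) (auto simp: dist_real_def)
  then show ?thesis by (rule lipschitz_on_continuous_on)
qed

text \<open>Shifting the variable of integration moves one of the two differences onto the other factor,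
  so the correlation of two merely Lipschitz functions has second differences of order \<open>h\<^sup>2\<close>.\<close>

lemma corr_second_difference:
  assumes h: "0 \<le> h" "h \<le> 2 * pi"
  shows "\<bar>corr (x + h) - 2 * corr x + corr (x - h)\<bar> \<le> exp 1 * (\<eta> / (2 * pi))\<^sup>2 * h\<^sup>2"
proof -
  have shift: "corr y = 1 / (2 * pi) * integral {0..2 * pi} (\<lambda>\<theta>. decay (\<theta> + h) * growth (\<theta> + (y + h)))" for y
  proof -
    let ?f = "\<lambda>\<theta>. decay \<theta> * growth (\<theta> + y)"
    have per: "?f (\<theta> + 2 * pi) = ?f \<theta>" for \<theta>
      using periodic[of \<theta>] periodic[of "\<theta> + y"] by (simp add: decay_def growth_def algebra_simps)
    have "continuous_on UNIV ?f" by (intro continuous_intros cont_decay cont_growth)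
    from integral_periodic_shift[OF this per h] show ?thesis
      by (simp add: corr_def add_ac)
  qed
  let ?d = "\<lambda>\<theta>. decay (\<theta> + h)"
  let ?g = "\<lambda>c \<theta>. growth (\<theta> + c)"
  have cont: "continuous_on A ?d" for A
    by (intro continuous_on_compose2[OF cont_decay[of UNIV]] continuous_intros) auto
  \<comment> \<open>\<open>?F\<close> is the product of
    \<open>decay \<theta> - decay (\<theta> + h)\<close> and
    \<open>growth (\<theta> + (x + h)) - growth (\<theta> + x)\<close>, each of order h. Expanded,
    its four averages are \<open>corr (x + h)\<close>, \<open>corr x\<close> and, by
    \<open>shift\<close> at x and x - h, again \<open>corr x\<close> and
    \<open>corr (x - h)\<close>.\<close>
  let ?F = "\<lambda>\<theta>. (decay \<theta> * ?g (x + h) \<theta> - decay \<theta> * ?g x \<theta>) - (?d \<theta> * ?g (x + h) \<theta> - ?d \<theta> * ?g x \<theta>)"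
  have int: "(\<lambda>\<theta>. ?d \<theta> * ?g c \<theta>) integrable_on {0..2 * pi}" for c
    by (intro integrable_continuous_real continuous_intros cont cont_growth)
  have "\<bar>1 / (2 * pi) * integral {0..2 * pi} ?F\<bar> \<le> exp 1 * (\<eta> / (2 * pi))\<^sup>2 * h\<^sup>2"
  proof (rule average_bound)
    show "?F integrable_on {0..2 * pi}" by (intro integrable_diff corr_integrable int)
    fix \<theta>
    have "\<bar>?F \<theta>\<bar> = \<bar>decay \<theta> - ?d \<theta>\<bar> * \<bar>?g (x + h) \<theta> - ?g x \<theta>\<bar>"
      by (simp add: algebra_simps flip: abs_mult)
    also have "\<dots> \<le> (\<eta> / (2 * pi) * h) * (exp 1 * (\<eta> / (2 * pi)) * h)"
      using decay_lip[of \<theta> "\<theta> + h"] growth_lip[of "\<theta> + (x + h)" "\<theta> + x"] h eta_nonneg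
      by (intro mult_mono) auto
    finally show "\<bar>?F \<theta>\<bar> \<le> exp 1 * (\<eta> / (2 * pi))\<^sup>2 * h\<^sup>2"
      by (simp add: power2_eq_square algebra_simps)
  qed
  moreover have "1 / (2 * pi) * integral {0..2 * pi} ?F = (corr (x + h) - corr x) - (corr x - corr (x - h))"
    using shift[of x] shift[of "x - h"]
    by (simp add: corr_def integral_diff integrable_diff corr_integrable int diff_divide_distrib add_divide_distrib)
  ultimately show ?thesis by (simp only:)
qed

text \<open>Two errors add up: replacing the integral by a Riemann sum with N^2 points gives the
  term in \<open>2 * \<eta>\<close>, and replacing the mean of products in each block by the product
  of means, a covariance, gives the term in \<open>\<eta>\<^sup>2\<close>.\<close>

lemma corr_node_error:
  assumes N: "0 < N"
  shows "\<bar>corr (2 * pi * real k / real N) - node_corr N k\<bar> \<le> exp 1 * (\<eta>\<^sup>2 + 2 * \<eta>) / (real N)\<^sup>2"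
proof -
  let ?\<alpha> = "2 * pi * real k / real N"
  define f where "f = (\<lambda>\<theta>. decay \<theta> * growth (\<theta> + ?\<alpha>))"
  define a where "a = (\<lambda>j i. decay (2 * pi * (real j + real i / real N) / real N))"
  define b where "b = (\<lambda>j i. growth (2 * pi * (real j + real i / real N) / real N))"
  \<comment> \<open>The product is treated as one exponential whose exponent
    \<open>\<rho> (x + ?\<alpha>) - \<rho> x\<close> is at most 1 and has twice the Lipschitz
    constant of \<rho>.\<close>
  have f_lip: "(exp 1 * (\<eta> / pi))-lipschitz_on UNIV f"
  proof (intro lipschitz_onI)
    fix x y
    have "\<bar>f x - f y\<bar> = \<bar>exp (\<rho> (x + ?\<alpha>) - \<rho> x) - exp (\<rho> (y + ?\<alpha>) - \<rho> y)\<bar>"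
      by (simp add: f_def decay_def growth_def flip: exp_add)
    also have "\<dots> \<le> exp 1 * \<bar>\<rho> (x + ?\<alpha>) - \<rho> x - (\<rho> (y + ?\<alpha>) - \<rho> y)\<bar>"
      using le_one[of "x + ?\<alpha>"] nonneg[of x] le_one[of "y + ?\<alpha>"] nonneg[of y]
      by (intro abs_exp_diff_le) linarith+
    also have "\<dots> \<le> exp 1 * (\<eta> / pi * \<bar>x - y\<bar>)"
    proof (intro mult_left_mono)
      have "\<bar>x + ?\<alpha> - (y + ?\<alpha>)\<bar> = \<bar>x - y\<bar>" by simp
      then have "\<bar>\<rho> (x + ?\<alpha>) - \<rho> x - (\<rho> (y + ?\<alpha>) - \<rho> y)\<bar> \<le> 2 * (\<eta> / (2 * pi) * \<bar>x - y\<bar>)"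
        using lip[of "x + ?\<alpha>" "y + ?\<alpha>"] lip[of x y] unfolding \<open>\<bar>x + ?\<alpha> - (y + ?\<alpha>)\<bar> = \<bar>x - y\<bar>\<close>
        by argo
      then show "\<bar>\<rho> (x + ?\<alpha>) - \<rho> x - (\<rho> (y + ?\<alpha>) - \<rho> y)\<bar> \<le> \<eta> / pi * \<bar>x - y\<bar>"
        by simp
    qed simp
    finally show "dist (f x) (f y) \<le> exp 1 * (\<eta> / pi) * dist x y"
      by (simp add: dist_real_def mult.assoc)
  qed (use eta_nonneg in auto)
  have riemann: "\<bar>corr ?\<alpha> - (\<Sum>i<N * N. f (2 * pi * real i / real (N * N))) / real (N * N)\<bar>
      \<le> exp 1 * (\<eta> / pi) * (2 * pi / real (N * N))"
    using left_riemann_sum_error[OF _ f_lip, of "N * N"] N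
    unfolding corr_def f_def[symmetric] by simp
  \<comment> \<open>Fine grid index j N + i is sample i of block j. Since the shift is a whole
    number of blocks, it carries this sample to sample i of block j + k, so the two factors stay
    aligned.\<close>
  have regroup: "(\<Sum>i<N * N. f (2 * pi * real i / real (N * N))) / real (N * N)
      = (\<Sum>j<N. (\<Sum>i<N. a j i * b (j + k) i / N) / N)"
  proof -
    have "f (2 * pi * real (j * N + i) / real (N * N)) = a j i * b (j + k) i" for j i
    proof -
      have 1: "2 * pi * real (j * N + i) / real (N * N) = 2 * pi * (real j + real i / real N) / real N"
        using N by (simp add: field_simps)
      have "2 * pi * (real j + real i / real N) / real N + ?\<alpha>
          = 2 * pi * (real (j + k) + real i / real N) / real N"
        using N by (simp add: field_simps)
      then show ?thesis unfolding f_def a_def b_def 1 by simp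
    qed
    then show ?thesis
      by (simp add: sum_rectangle sum_divide_distrib)
  qed
  have close: "\<bar>2 * pi * (real j + real i / real N) / real N - 2 * pi * (real j + real i' / real N) / real N\<bar>
      \<le> 2 * pi / real N" if "i < N" "i' < N" for i i' j
  proof -
    have "2 * pi * (real j + real i / real N) / real N - 2 * pi * (real j + real i' / real N) / real N
        = 2 * pi / real N * ((real i - real i') / real N)"
      using N by (simp add: field_simps)
    moreover have "\<bar>(real i - real i') / real N\<bar> \<le> 1"
      using that by (auto simp: field_simps abs_if)
    ultimately show ?thesis
      using mult_left_mono[of "\<bar>(real i - real i') / real N\<bar>" 1 "2 * pi / real N"]
      by (simp add: abs_mult)
  qed
  \<comment> \<open>Samples in one block are at most 2 pi / N apart, so the two factors oscillate
    there by at most \<eta>/N and e \<eta>/N.\<close>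
  have cov: "\<bar>(\<Sum>i<N. a j i * b (j + k) i / N) - block_mean decay N j * block_mean growth N (j + k)\<bar>
      \<le> \<eta> / N * (exp 1 * \<eta> / N)" for j
    unfolding block_mean_def a_def b_def
  proof (rule covariance_bound[OF N])
    fix i i' assume i: "i < N" "i' < N"
    let ?p = "\<lambda>j i. 2 * pi * (real j + real i / real N) / real N"
    have "\<eta> / (2 * pi) * \<bar>?p j i - ?p j i'\<bar> \<le> \<eta> / (2 * pi) * (2 * pi / real N)"
      using eta_nonneg by (intro mult_left_mono close i) auto
    then show "\<bar>decay (?p j i) - decay (?p j i')\<bar> \<le> \<eta> / N"
      using decay_lip[of "?p j i" "?p j i'"] by simp
    have "exp 1 * (\<eta> / (2 * pi)) * \<bar>?p (j + k) i - ?p (j + k) i'\<bar> \<le> exp 1 * (\<eta> / (2 * pi)) * (2 * pi / real N)"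
      using eta_nonneg by (intro mult_left_mono close i) auto
    then show "\<bar>growth (?p (j + k) i) - growth (?p (j + k) i')\<bar> \<le> exp 1 * \<eta> / N"
      using growth_lip[of "?p (j + k) i" "?p (j + k) i'"] by simp
  qed
  have "\<bar>(\<Sum>j<N. (\<Sum>i<N. a j i * b (j + k) i / N) / N) - node_corr N k\<bar>
      = \<bar>\<Sum>j<N. ((\<Sum>i<N. a j i * b (j + k) i / N) - block_mean decay N j * block_mean growth N (j + k)) / N\<bar>"
    by (simp add: node_corr_def diff_divide_distrib flip: sum_subtractf)
  also have "\<dots> \<le> (\<Sum>j<N. \<eta> / N * (exp 1 * \<eta> / N) / N)"
    by (intro order_trans[OF sum_abs] sum_mono, simp only: abs_divide abs_of_nat)
      (intro divide_right_mono cov of_nat_0_le_iff)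
  also have "\<dots> = exp 1 * \<eta>\<^sup>2 / (real N)\<^sup>2" using N by (simp add: power2_eq_square)
  finally have "\<bar>(\<Sum>j<N. (\<Sum>i<N. a j i * b (j + k) i / N) / N) - node_corr N k\<bar> \<le> exp 1 * \<eta>\<^sup>2 / (real N)\<^sup>2" .
  moreover have "exp 1 * (\<eta> / pi) * (2 * pi / real (N * N)) = exp 1 * (2 * \<eta>) / (real N)\<^sup>2"
    by (simp add: power2_eq_square)
  moreover have "exp 1 * (\<eta>\<^sup>2 + 2 * \<eta>) / (real N)\<^sup>2 = exp 1 * \<eta>\<^sup>2 / (real N)\<^sup>2 + exp 1 * (2 * \<eta>) / (real N)\<^sup>2"
    by (simp add: algebra_simps add_divide_distrib)
  ultimately show ?thesis
    using riemann regroup by linarith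
qed

text \<open>The coefficient 5/4 is 1 from the nodes plus 1/4 from linear interpolation of the exact
  values. Interpolating inexact node values adds only a convex combination of the two node errors,
  hence no more than their common bound.\<close>

lemma corr_interpolation_error:
  assumes N: "0 < N" and x: "0 \<le> x" "x \<le> 2 * pi / real N"
  shows "\<bar>corr (2 * pi * real k / real N + x)
      - (node_corr N k + x / (2 * pi / real N) * (node_corr N (Suc k) - node_corr N k))\<bar>
      \<le> exp 1 * (5 / 4 * \<eta>\<^sup>2 + 2 * \<eta>) / (real N)\<^sup>2"
proof -
  let ?\<delta> = "2 * pi / real N" and ?u = "2 * pi * real k / real N"
  define t where "t = x / ?\<delta>"
  have t: "0 \<le> t" "t \<le> 1" using x N by (auto simp: t_def field_simps)
  let ?B = "exp 1 * (\<eta>\<^sup>2 + 2 * \<eta>) / (real N)\<^sup>2"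
  have "?\<delta> \<le> 2 * pi" using N by (simp add: field_simps)
  then have "\<bar>corr (?u + x) - (corr ?u + x / ?\<delta> * (corr (?u + ?\<delta>) - corr ?u))\<bar>
      \<le> exp 1 * (\<eta> / (2 * pi))\<^sup>2 * ?\<delta>\<^sup>2 / 4"
    using x by (intro linear_interpolation_error cont_corr corr_second_difference) auto
  moreover have "exp 1 * (\<eta> / (2 * pi))\<^sup>2 * ?\<delta>\<^sup>2 / 4 = exp 1 * \<eta>\<^sup>2 / 4 / (real N)\<^sup>2"
    by (simp add: field_simps)
  moreover have "?u + ?\<delta> = 2 * pi * real (Suc k) / real N"
    by (simp add: add_divide_distrib distrib_left)
  ultimately have 1: "\<bar>corr (?u + x) - (corr ?u + t * (corr (2 * pi * real (Suc k) / real N) - corr ?u))\<bar>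
      \<le> exp 1 * \<eta>\<^sup>2 / 4 / (real N)\<^sup>2"
    by (simp add: t_def)
  define p where "p = corr ?u - node_corr N k"
  define q where "q = corr (2 * pi * real (Suc k) / real N) - node_corr N (Suc k)"
  have pq: "\<bar>p\<bar> \<le> ?B" "\<bar>q\<bar> \<le> ?B"
    unfolding p_def q_def by (rule corr_node_error[OF N])+
  have "\<bar>(1 - t) * p + t * q\<bar> \<le> \<bar>(1 - t) * p\<bar> + \<bar>t * q\<bar>" by simp
  also have "\<dots> = (1 - t) * \<bar>p\<bar> + t * \<bar>q\<bar>" using t by (simp add: abs_mult)
  also have "\<dots> \<le> (1 - t) * ?B + t * ?B"
    using t pq by (intro add_mono mult_left_mono) auto
  also have "\<dots> = ?B" by (simp only: left_diff_distrib mult_1_left diff_add_cancel)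
  finally have 2: "\<bar>(1 - t) * p + t * q\<bar> \<le> ?B" .
  have "corr (?u + x) - (node_corr N k + t * (node_corr N (Suc k) - node_corr N k))
      = (corr (?u + x) - (corr ?u + t * (corr (2 * pi * real (Suc k) / real N) - corr ?u)))
        + ((1 - t) * p + t * q)"
    by (simp add: p_def q_def algebra_simps)
  then have "\<bar>corr (?u + x) - (node_corr N k + t * (node_corr N (Suc k) - node_corr N k))\<bar>
      \<le> exp 1 * \<eta>\<^sup>2 / 4 / (real N)\<^sup>2 + ?B"
    by (simp only: order_trans[OF abs_triangle_ineq add_mono[OF 1 2]])
  also have "\<dots> = exp 1 * (5 / 4 * \<eta>\<^sup>2 + 2 * \<eta>) / (real N)\<^sup>2"
    using N by (simp add: field_simps)
  finally show ?thesis unfolding t_def .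
qed

end


section \<open>Total correctness with time bounds\<close>

text \<open>A total correctness judgement in which T is merely an upper bound on the running time,
  so that bounds of subprograms can be rounded up and added.\<close>

definition terminates ::
  "(real \<Rightarrow> real) \<Rightarrow> (real \<Rightarrow> real) \<Rightarrow> com \<Rightarrow> state \<Rightarrow> nat \<Rightarrow> (state \<Rightarrow> bool) \<Rightarrow> bool" where
  "terminates \<rho>1 \<rho>2 c s T Q \<longleftrightarrow> (\<exists>t s'. exec \<rho>1 \<rho>2 c s t s' \<and> t \<le> T \<and> Q s')"

lemma terminates_weaken:
  "terminates \<rho>1 \<rho>2 c s T Q \<Longrightarrow> T \<le> T' \<Longrightarrow> (\<And>s'. Q s' \<Longrightarrow> Q' s') \<Longrightarrow> terminates \<rho>1 \<rho>2 c s T' Q'"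
  unfolding terminates_def by (meson order_trans)

lemma terminates_ISet:
  "Q ((fst s)(v := ival i s), snd s) \<Longrightarrow> terminates \<rho>1 \<rho>2 (ISet v i) s 1 Q"
  unfolding terminates_def using exec.ISet by blast

lemma terminates_RSet:
  "Q (fst s, (snd s)(a := (snd s a)(ival i s := rval \<rho>1 \<rho>2 e s))) \<Longrightarrow> terminates \<rho>1 \<rho>2 (RSet a i e) s 1 Q"
  unfolding terminates_def using exec.RSet by blast

lemma terminates_Seq:
  assumes "terminates \<rho>1 \<rho>2 c s T R" "\<And>s'. R s' \<Longrightarrow> terminates \<rho>1 \<rho>2 d s' T' Q"
  shows "terminates \<rho>1 \<rho>2 (Seq c d) s (T + T') Q"
proof -
  obtain t s' where 1: "exec \<rho>1 \<rho>2 c s t s'" "t \<le> T" "R s'"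
    using assms(1) unfolding terminates_def by blast
  obtain t' s'' where 2: "exec \<rho>1 \<rho>2 d s' t' s''" "t' \<le> T'" "Q s''"
    using assms(2)[OF 1(3)] unfolding terminates_def by blast
  show ?thesis
    unfolding terminates_def using exec.Seq[OF 1(1) 2(1)] 1 2 by (meson add_mono)
qed

text \<open>Pushes the state forward through an assignment, so that straight-line code needs no
  intermediate assertions.\<close>

lemma terminates_RSet_Seq:
  assumes "terminates \<rho>1 \<rho>2 d (fst s, (snd s)(a := (snd s a)(ival i s := rval \<rho>1 \<rho>2 e s))) T Q"
  shows "terminates \<rho>1 \<rho>2 (Seq (RSet a i e) d) s (1 + T) Q"
  using assms exec.Seq[OF exec.RSet] unfolding terminates_def by (meson add_left_mono)

text \<open>The invariant is indexed by the number of completed rounds. Each remaining round costs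
  its test and its body; the last summand 1 is the failing test.\<close>

lemma terminates_While:
  assumes step: "\<And>i s. i < m \<Longrightarrow> I i s \<Longrightarrow>
        rval \<rho>1 \<rho>2 e s < rval \<rho>1 \<rho>2 f s \<and> terminates \<rho>1 \<rho>2 c s T (I (Suc i))"
    and stop: "\<And>s. I m s \<Longrightarrow> \<not> rval \<rho>1 \<rho>2 e s < rval \<rho>1 \<rho>2 f s"
    and init: "I i s" "i \<le> m"
  shows "terminates \<rho>1 \<rho>2 (WhileLess e f c) s ((m - i) * (T + 1) + 1) (I m)"
  using init
proof (induction "m - i" arbitrary: i s)
  case 0
  then have "i = m" by simp
  then show ?case
    unfolding terminates_def using exec.WhileFalse[OF stop] 0 by fastforce
next
  case (Suc n)
  then have i: "i < m" by simp
  obtain t s' where 1: "exec \<rho>1 \<rho>2 c s t s'" "t \<le> T" "I (Suc i) s'"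
    using step[OF i Suc.prems(1)] unfolding terminates_def by blast
  have n: "n = m - Suc i" using Suc.hyps(2) by simp
  obtain t' s'' where 2: "exec \<rho>1 \<rho>2 (WhileLess e f c) s' t' s''"
      "t' \<le> (m - Suc i) * (T + 1) + 1" "I m s''"
    using Suc.hyps(1)[OF n 1(3)] i unfolding terminates_def by auto
  have "1 + t + t' \<le> (m - i) * (T + 1) + 1"
    using 1 2 unfolding Suc.hyps(2)[symmetric] n[symmetric] by simp
  then show ?case
    unfolding terminates_def using exec.WhileTrue[OF _ 1(1) 2(1)] step[OF i Suc.prems(1)] 2(3) by blast
qed

definition for_loop :: "nat \<Rightarrow> iexp \<Rightarrow> com \<Rightarrow> com" where
  "for_loop v n c = Seq (ISet v (INum 0))
     (WhileLess (OfIdx (IReg v)) (OfIdx n) (Seq c (ISet v (IAdd (IReg v) (INum 1)))))"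

text \<open>The body must preserve the counter, and the invariant must fix the value of the bound,
  which is evaluated anew in each round. A round costs T plus test and increment; the final 2 pays
  for initialisation and the failing test.\<close>

lemma terminates_for_loop:
  assumes inv: "\<And>i s. I i s \<Longrightarrow> fst s v = i \<and> ival n s = m"
    and init: "I 0 ((fst s)(v := 0), snd s)"
    and step: "\<And>i s. i < m \<Longrightarrow> I i s \<Longrightarrow>
        terminates \<rho>1 \<rho>2 c s T (\<lambda>s'. fst s' v = i \<and> I (Suc i) ((fst s')(v := Suc i), snd s'))"
  shows "terminates \<rho>1 \<rho>2 (for_loop v n c) s (m * (T + 2) + 2) (I m)"
proof -
  have "terminates \<rho>1 \<rho>2 (for_loop v n c) s (1 + ((m - 0) * ((T + 1) + 1) + 1)) (I m)"
    unfolding for_loop_def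
  proof (rule terminates_Seq[where R = "I 0"], rule terminates_ISet)
    show "I 0 ((fst s)(v := ival (INum 0) s), snd s)" using init by simp
    fix s0 assume "I 0 s0"
    then show "terminates \<rho>1 \<rho>2 (WhileLess (OfIdx (IReg v)) (OfIdx n) (Seq c (ISet v (IAdd (IReg v) (INum 1)))))
        s0 ((m - 0) * ((T + 1) + 1) + 1) (I m)"
    proof (rule terminates_While[rotated 2])
      fix i s assume i: "i < m" "I i s"
      show "rval \<rho>1 \<rho>2 (OfIdx (IReg v)) s < rval \<rho>1 \<rho>2 (OfIdx n) s \<and>
          terminates \<rho>1 \<rho>2 (Seq c (ISet v (IAdd (IReg v) (INum 1)))) s (T + 1) (I (Suc i))"
      proof
        show "rval \<rho>1 \<rho>2 (OfIdx (IReg v)) s < rval \<rho>1 \<rho>2 (OfIdx n) s"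
          using i inv[OF i(2)] by simp
        show "terminates \<rho>1 \<rho>2 (Seq c (ISet v (IAdd (IReg v) (INum 1)))) s (T + 1) (I (Suc i))"
          by (rule terminates_Seq[OF step[OF i]], rule terminates_ISet) auto
      qed
    next
      fix s assume "I m s"
      from inv[OF this] show "\<not> rval \<rho>1 \<rho>2 (OfIdx (IReg v)) s < rval \<rho>1 \<rho>2 (OfIdx n) s" by simp
    qed simp
  qed
  then show ?thesis by (rule terminates_weaken) auto
qed


section \<open>The algorithm\<close>

text \<open>The constant 12 makes \<open>12 * (\<eta>\<^sup>2 + \<eta>) / N\<^sup>2\<close> an upper bound of the sum of the interpolation errors
  \<open>exp 1 * (5 / 4 * \<eta>\<^sup>2 + 2 * \<eta>) / N\<^sup>2\<close> for the two shapes.\<close>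

definition grid_size :: "real \<Rightarrow> real \<Rightarrow> nat" where
  "grid_size \<eta> \<epsilon> = (LEAST n. 1 \<le> n \<and> 12 * (\<eta>\<^sup>2 + \<eta>) \<le> real n * real n * \<epsilon>)"

lemma grid_size:
  assumes "0 < \<epsilon>"
  shows "1 \<le> grid_size \<eta> \<epsilon>" "12 * (\<eta>\<^sup>2 + \<eta>) \<le> real (grid_size \<eta> \<epsilon>) * real (grid_size \<eta> \<epsilon>) * \<epsilon>"
proof -
  obtain n :: nat where n: "12 * (\<eta>\<^sup>2 + \<eta>) / \<epsilon> \<le> real n"
    using real_arch_simple by blast
  have "12 * (\<eta>\<^sup>2 + \<eta>) \<le> real n * \<epsilon>" using n assms by (simp add: field_simps)
  also have "\<dots> \<le> real (Suc n) * real (Suc n) * \<epsilon>"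
    using assms by (intro mult_right_mono) (auto simp: algebra_simps)
  finally have "1 \<le> Suc n \<and> 12 * (\<eta>\<^sup>2 + \<eta>) \<le> real (Suc n) * real (Suc n) * \<epsilon>" by simp
  then have "1 \<le> grid_size \<eta> \<epsilon> \<and> 12 * (\<eta>\<^sup>2 + \<eta>) \<le> real (grid_size \<eta> \<epsilon>) * real (grid_size \<eta> \<epsilon>) * \<epsilon>"
    unfolding grid_size_def by (rule LeastI)
  then show "1 \<le> grid_size \<eta> \<epsilon>" "12 * (\<eta>\<^sup>2 + \<eta>) \<le> real (grid_size \<eta> \<epsilon>) * real (grid_size \<eta> \<epsilon>) * \<epsilon>"
    by auto
qed

text \<open>By minimality the defining inequality fails one step below N, which bounds (N - 1)^2;
  for N \<ge> 2 moreover N \<le> 2 (N - 1), whence the factor 4. The summand 1 covers N = 1.\<close>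

lemma grid_size_upper:
  assumes \<epsilon>: "0 < \<epsilon>" and \<eta>: "0 \<le> \<eta>"
  shows "(real (grid_size \<eta> \<epsilon>))\<^sup>2 \<le> 4 * (1 + 12 * (\<eta>\<^sup>2 + \<eta>) / \<epsilon>)"
proof (cases "grid_size \<eta> \<epsilon> \<le> 1")
  case True
  then have "(real (grid_size \<eta> \<epsilon>))\<^sup>2 \<le> 1\<^sup>2" by (intro power_mono) auto
  also have "1\<^sup>2 \<le> 4 * (1 + w)" if "0 \<le> w" for w :: real using that by simp
  then have "1\<^sup>2 \<le> 4 * (1 + 12 * (\<eta>\<^sup>2 + \<eta>) / \<epsilon>)" using assms by simp
  finally show ?thesis .
next
  case False
  then obtain n where n: "grid_size \<eta> \<epsilon> = Suc n" "1 \<le> n" by (cases "grid_size \<eta> \<epsilon>") auto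
  then have "\<not> (1 \<le> n \<and> 12 * (\<eta>\<^sup>2 + \<eta>) \<le> real n * real n * \<epsilon>)"
    using not_less_Least[of n "\<lambda>n. 1 \<le> n \<and> 12 * (\<eta>\<^sup>2 + \<eta>) \<le> real n * real n * \<epsilon>"]
    by (simp add: grid_size_def)
  then have "(real n)\<^sup>2 \<le> 12 * (\<eta>\<^sup>2 + \<eta>) / \<epsilon>" using n \<epsilon> by (simp add: field_simps power2_eq_square)
  then have "4 * (real n)\<^sup>2 \<le> 4 * (1 + 12 * (\<eta>\<^sup>2 + \<eta>) / \<epsilon>)"
    by (intro mult_left_mono) auto
  moreover have "(real (Suc n))\<^sup>2 \<le> (2 * real n)\<^sup>2" using n by (intro power_mono) auto
  ultimately show ?thesis unfolding n(1) power_mult_distrib by simp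
qed

text \<open>The machine cannot round a real to a natural number, so N is found by counting up. These
  O(N) steps are dominated by the quadratic phases.\<close>

definition grid_program :: com where
  "grid_program = Seq (ISet 0 (INum 1))
     (WhileLess
       (Mul (Mul (OfIdx (IReg 0)) (OfIdx (IReg 0))) (Cell 0 (INum 1)))
       (Mul (OfIdx (INum 12)) (Add (Mul (Cell 0 (INum 0)) (Cell 0 (INum 0))) (Cell 0 (INum 0))))
       (ISet 0 (IAdd (IReg 0) (INum 1))))"

lemma grid_program:
  assumes \<epsilon>: "0 < \<epsilon>"
  shows "terminates \<rho>1 \<rho>2 grid_program (init_state \<eta> \<epsilon>) (2 * grid_size \<eta> \<epsilon>)
    (\<lambda>s. fst s 0 = grid_size \<eta> \<epsilon> \<and> snd s = snd (init_state \<eta> \<epsilon>))"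
proof -
  let ?N = "grid_size \<eta> \<epsilon>"
  let ?e = "Mul (Mul (OfIdx (IReg 0)) (OfIdx (IReg 0))) (Cell 0 (INum 1))"
  let ?f = "Mul (OfIdx (INum 12)) (Add (Mul (Cell 0 (INum 0)) (Cell 0 (INum 0))) (Cell 0 (INum 0)))"
  \<comment> \<open>The search starts at 1, so after i rounds the register holds i + 1 and the loop
    runs N - 1 times.\<close>
  define I where "I = (\<lambda>i (s :: state). fst s 0 = Suc i \<and> snd s = snd (init_state \<eta> \<epsilon>))"
  have cond: "rval \<rho>1 \<rho>2 ?e s < rval \<rho>1 \<rho>2 ?f s \<longleftrightarrow>
      \<not> 12 * (\<eta>\<^sup>2 + \<eta>) \<le> real (Suc i) * real (Suc i) * \<epsilon>" if "I i s" for i s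
    using that by (auto simp: I_def init_state_def power2_eq_square not_le)
  have "terminates \<rho>1 \<rho>2 grid_program (init_state \<eta> \<epsilon>) (1 + ((?N - 1 - 0) * (1 + 1) + 1)) (I (?N - 1))"
    unfolding grid_program_def
  proof (rule terminates_Seq[where R = "I 0"], rule terminates_ISet)
    show "I 0 ((fst (init_state \<eta> \<epsilon>))(0 := ival (INum 1) (init_state \<eta> \<epsilon>)), snd (init_state \<eta> \<epsilon>))"
      by (simp add: I_def)
    fix s0 assume "I 0 s0"
    then show "terminates \<rho>1 \<rho>2 (WhileLess ?e ?f (ISet 0 (IAdd (IReg 0) (INum 1)))) s0
        ((?N - 1 - 0) * (1 + 1) + 1) (I (?N - 1))"
    proof (rule terminates_While[rotated 2])
      fix i s assume i: "i < ?N - 1" "I i s"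
      then have "Suc i < ?N" by simp
      then have "\<not> 12 * (\<eta>\<^sup>2 + \<eta>) \<le> real (Suc i) * real (Suc i) * \<epsilon>"
        using not_less_Least[of "Suc i" "\<lambda>n. 1 \<le> n \<and> 12 * (\<eta>\<^sup>2 + \<eta>) \<le> real n * real n * \<epsilon>"]
        by (simp add: grid_size_def)
      moreover have "terminates \<rho>1 \<rho>2 (ISet 0 (IAdd (IReg 0) (INum 1))) s 1 (I (Suc i))"
        using i by (intro terminates_ISet) (simp add: I_def)
      ultimately show "rval \<rho>1 \<rho>2 ?e s < rval \<rho>1 \<rho>2 ?f s \<and>
          terminates \<rho>1 \<rho>2 (ISet 0 (IAdd (IReg 0) (INum 1))) s 1 (I (Suc i))"
        using cond[OF i(2)] by blast
    next
      fix s assume "I (?N - 1) s"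
      then show "\<not> rval \<rho>1 \<rho>2 ?e s < rval \<rho>1 \<rho>2 ?f s"
        using cond[of "?N - 1" s] grid_size[OF \<epsilon>, of \<eta>] by simp
    qed simp
  qed
  then show ?thesis
    using grid_size(1)[OF \<epsilon>, of \<eta>] by (rule_tac terminates_weaken) (auto simp: I_def)
qed

section \<open>Computing the block means\<close>

definition angle :: rexp where
  "angle = Div (Mul (Mul (OfIdx (INum 2)) Pi)
     (Add (OfIdx (IReg 1)) (Div (OfIdx (IReg 2)) (OfIdx (IReg 0))))) (OfIdx (IReg 0))"

definition accumulate :: "nat \<Rightarrow> iexp \<Rightarrow> rexp \<Rightarrow> com" where
  "accumulate a i e = RSet a i (Add (Cell a i) e)"

text \<open>Register 0 holds the number \<open>N\<close> of blocks, registers 1 and 2 are loop counters. Arrays 1 to 4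
  receive the block means of \<open>exp (- \<rho>1)\<close>, \<open>exp \<rho>1\<close>, \<open>exp (- \<rho>2)\<close>, \<open>exp \<rho>2\<close>, array 5 the differences
  of the approximate sketches at the grid points, and cell 0 of array 6 the squared norm. The block
  means cover two periods, so that the indices \<open>j + k\<close> of the correlation sums need no reduction
  modulo \<open>N\<close>.\<close>

definition means_program :: com where
  "means_program = for_loop 1 (IAdd (IReg 0) (IReg 0)) (for_loop 2 (IReg 0)
     (Seq (accumulate 1 (IReg 1) (Div (Exp (Sub (OfIdx (INum 0)) (Radius1 angle))) (OfIdx (IReg 0))))
     (Seq (accumulate 2 (IReg 1) (Div (Exp (Radius1 angle)) (OfIdx (IReg 0))))
     (Seq (accumulate 3 (IReg 1) (Div (Exp (Sub (OfIdx (INum 0)) (Radius2 angle))) (OfIdx (IReg 0))))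
          (accumulate 4 (IReg 1) (Div (Exp (Radius2 angle)) (OfIdx (IReg 0))))))))"

text \<open>The number of terms accumulated in cell \<open>l\<close> after \<open>i\<close> rounds of the inner loop
  (of \<open>N\<close> rounds each) in round \<open>j\<close> of the outer loop.\<close>

definition progress :: "nat \<Rightarrow> nat \<Rightarrow> nat \<Rightarrow> nat \<Rightarrow> nat" where
  "progress N j i l = (if l < j then N else if l = j then i else 0)"

lemma progress_simps:
  "progress N 0 0 l = 0"
  "progress N j N l = progress N (Suc j) 0 l"
  "l \<noteq> j \<Longrightarrow> progress N j (Suc i) l = progress N j i l"
  "progress N j i j = i"
  "l < j \<Longrightarrow> progress N j i l = N"
  by (auto simp: progress_def)

definition partial_mean :: "(real \<Rightarrow> real) \<Rightarrow> nat \<Rightarrow> nat \<Rightarrow> nat \<Rightarrow> nat \<Rightarrow> real" where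
  "partial_mean f N j i l =
     (\<Sum>i'<progress N j i l. f (2 * pi * (real l + real i' / real N) / real N) / real N)"

text \<open>The obligations of the loop invariants: cleared memory at the start, passing from a
  finished block to the next, reading off finished blocks, and one accumulation step.\<close>

lemma partial_mean_simps:
  "partial_mean f N 0 0 = (\<lambda>_. 0)"
  "partial_mean f N j N = partial_mean f N (Suc j) 0"
  "l < j \<Longrightarrow> partial_mean f N j i l = block_mean f N l"
  "partial_mean f N j (Suc i) = (partial_mean f N j i)
     (j := partial_mean f N j i j + f (2 * pi * (real j + real i / real N) / real N) / real N)"
  by (auto simp: partial_mean_def progress_simps block_mean_def fun_eq_iff)

lemma means_program:
  assumes s: "fst s 0 = N" "\<And>a. a \<noteq> 0 \<Longrightarrow> snd s a = (\<lambda>_. 0)"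
  shows "terminates \<rho>1 \<rho>2 means_program s (2 * N * (N * 6 + 4) + 2)
    (\<lambda>s'. fst s' 0 = N \<and>
       (\<forall>l < 2 * N. snd s' 1 l = block_mean (\<lambda>\<theta>. exp (- \<rho>1 \<theta>)) N l \<and>
         snd s' 2 l = block_mean (\<lambda>\<theta>. exp (\<rho>1 \<theta>)) N l \<and>
         snd s' 3 l = block_mean (\<lambda>\<theta>. exp (- \<rho>2 \<theta>)) N l \<and>
         snd s' 4 l = block_mean (\<lambda>\<theta>. exp (\<rho>2 \<theta>)) N l) \<and>
       snd s' 5 = (\<lambda>_. 0) \<and> snd s' 6 = (\<lambda>_. 0))"
proof -
  \<comment> \<open>Arrays 5 and 6 are carried along because the later phases accumulate into them
    and rely on their initial zeros.\<close>
  define M where "M = (\<lambda>j i (h :: nat \<Rightarrow> nat \<Rightarrow> real).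
    h 1 = partial_mean (\<lambda>\<theta>. exp (- \<rho>1 \<theta>)) N j i \<and> h 2 = partial_mean (\<lambda>\<theta>. exp (\<rho>1 \<theta>)) N j i \<and>
    h 3 = partial_mean (\<lambda>\<theta>. exp (- \<rho>2 \<theta>)) N j i \<and> h 4 = partial_mean (\<lambda>\<theta>. exp (\<rho>2 \<theta>)) N j i \<and>
    h 5 = (\<lambda>_. 0) \<and> h 6 = (\<lambda>_. 0))"
  define I where "I = (\<lambda>j (s :: state). fst s 0 = N \<and> fst s 1 = j \<and> M j 0 (snd s))"
  define I' where "I' = (\<lambda>j i (s :: state). fst s 0 = N \<and> fst s 1 = j \<and> fst s 2 = i \<and> M j i (snd s))"
  let ?body = "Seq (accumulate 1 (IReg 1) (Div (Exp (Sub (OfIdx (INum 0)) (Radius1 angle))) (OfIdx (IReg 0))))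
       (Seq (accumulate 2 (IReg 1) (Div (Exp (Radius1 angle)) (OfIdx (IReg 0))))
       (Seq (accumulate 3 (IReg 1) (Div (Exp (Sub (OfIdx (INum 0)) (Radius2 angle))) (OfIdx (IReg 0))))
            (accumulate 4 (IReg 1) (Div (Exp (Radius2 angle)) (OfIdx (IReg 0))))))"
  have "terminates \<rho>1 \<rho>2 means_program s (2 * N * ((N * (4 + 2) + 2) + 2) + 2) (I (2 * N))"
    unfolding means_program_def
  proof (rule terminates_for_loop)
    show "I 0 ((fst s)(1 := 0), snd s)"
      using s by (simp add: I_def M_def partial_mean_simps)
    fix j s assume j: "j < 2 * N" "I j s"
    show "terminates \<rho>1 \<rho>2 (for_loop 2 (IReg 0) ?body) s (N * (4 + 2) + 2)
     (\<lambda>s'. fst s' 1 = j \<and> I (Suc j) ((fst s')(1 := Suc j), snd s'))"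
    proof (rule terminates_weaken[where Q = "I' j N"], rule terminates_for_loop)
      show "I' j 0 ((fst s)(2 := 0), snd s)" using j by (simp add: I_def I'_def)
      fix i s assume i: "i < N" "I' j i s"
      have "terminates \<rho>1 \<rho>2 ?body s (1 + (1 + (1 + 1)))
       (\<lambda>s'. fst s' = fst s \<and> M j (Suc i) (snd s'))"
        unfolding accumulate_def
        by (intro terminates_RSet_Seq terminates_RSet)
          (use i in \<open>simp add: I'_def M_def partial_mean_simps angle_def\<close>)
      then show "terminates \<rho>1 \<rho>2 ?body s 4
       (\<lambda>s'. fst s' 2 = i \<and> I' j (Suc i) ((fst s')(2 := Suc i), snd s'))"
        using i by (elim terminates_weaken) (auto simp: I'_def)
    qed (auto simp: I_def I'_def M_def partial_mean_simps)
  qed (auto simp: I_def)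
  then show ?thesis
    by (rule terminates_weaken) (auto simp: I_def M_def partial_mean_simps algebra_simps)
qed

section \<open>Correlation sums at the grid nodes\<close>

definition node_sums :: "(nat \<Rightarrow> real) \<Rightarrow> (nat \<Rightarrow> real) \<Rightarrow> (nat \<Rightarrow> real) \<Rightarrow> (nat \<Rightarrow> real) \<Rightarrow> nat \<Rightarrow> nat \<Rightarrow> real" where
  "node_sums A1 B1 A2 B2 N k =
     (\<Sum>j<N. (A1 j * B1 (j + k) - A2 j * B2 (j + k)) / real N)"

text \<open>The nodes run from 0 to N inclusive, so the last interval finds its right end in node N
  without wrapping around. The largest index read is (N - 1) + N, still within the two stored
  periods.\<close>

definition nodes_program :: com where
  "nodes_program = for_loop 1 (IAdd (IReg 0) (INum 1)) (for_loop 2 (IReg 0)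
     (accumulate 5 (IReg 1) (Div
        (Sub (Mul (Cell 1 (IReg 2)) (Cell 2 (IAdd (IReg 2) (IReg 1))))
             (Mul (Cell 3 (IReg 2)) (Cell 4 (IAdd (IReg 2) (IReg 1)))))
        (OfIdx (IReg 0)))))"

lemma nodes_program:
  assumes s: "fst s 0 = N" "snd s 5 = (\<lambda>_. 0)"
  shows "terminates \<rho>1 \<rho>2 nodes_program s ((N + 1) * (N * 3 + 4) + 2)
    (\<lambda>s'. fst s' 0 = N \<and> snd s' 6 = snd s 6 \<and>
       (\<forall>k\<le>N. snd s' 5 k = node_sums (snd s 1) (snd s 2) (snd s 3) (snd s 4) N k))"
proof -
  define P where "P = (\<lambda>k j l. \<Sum>j'<progress N k j l.
    (snd s 1 j' * snd s 2 (j' + l) - snd s 3 j' * snd s 4 (j' + l)) / real N)"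
  have P: "P 0 0 = (\<lambda>_. 0)" "P k N = P (Suc k) 0"
    "P k (Suc j) = (P k j)(k := P k j k + (snd s 1 j * snd s 2 (j + k) - snd s 3 j * snd s 4 (j + k)) / real N)"
    "l < k \<Longrightarrow> P k 0 l = node_sums (snd s 1) (snd s 2) (snd s 3) (snd s 4) N l" for k j l
    by (auto simp: P_def progress_simps node_sums_def fun_eq_iff)
  define M where "M = (\<lambda>k j (h :: nat \<Rightarrow> nat \<Rightarrow> real).
    h 1 = snd s 1 \<and> h 2 = snd s 2 \<and> h 3 = snd s 3 \<and> h 4 = snd s 4 \<and> h 6 = snd s 6 \<and> h 5 = P k j)"
  define I where "I = (\<lambda>k (s :: state). fst s 0 = N \<and> fst s 1 = k \<and> M k 0 (snd s))"
  define I' where "I' = (\<lambda>k j (s :: state). fst s 0 = N \<and> fst s 1 = k \<and> fst s 2 = j \<and> M k j (snd s))"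
  let ?c = "accumulate 5 (IReg 1) (Div
        (Sub (Mul (Cell 1 (IReg 2)) (Cell 2 (IAdd (IReg 2) (IReg 1))))
             (Mul (Cell 3 (IReg 2)) (Cell 4 (IAdd (IReg 2) (IReg 1)))))
        (OfIdx (IReg 0)))"
  have "terminates \<rho>1 \<rho>2 nodes_program s ((N + 1) * ((N * (1 + 2) + 2) + 2) + 2) (I (N + 1))"
    unfolding nodes_program_def
  proof (rule terminates_for_loop)
    show "I 0 ((fst s)(1 := 0), snd s)"
      using s by (simp add: I_def M_def P)
    fix k s assume k: "k < N + 1" "I k s"
    show "terminates \<rho>1 \<rho>2 (for_loop 2 (IReg 0) ?c) s (N * (1 + 2) + 2)
      (\<lambda>s'. fst s' 1 = k \<and> I (Suc k) ((fst s')(1 := Suc k), snd s'))"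
    proof (rule terminates_weaken[where Q = "I' k N"], rule terminates_for_loop)
      show "I' k 0 ((fst s)(2 := 0), snd s)" using k by (simp add: I_def I'_def)
      fix j s assume j: "j < N" "I' k j s"
      show "terminates \<rho>1 \<rho>2 ?c s 1
        (\<lambda>s'. fst s' 2 = j \<and> I' k (Suc j) ((fst s')(2 := Suc j), snd s'))"
        unfolding accumulate_def
        by (rule terminates_RSet) (use j in \<open>simp add: I'_def M_def P\<close>)
    qed (auto simp: I_def I'_def M_def P)
  qed (auto simp: I_def)
  then show ?thesis
    by (rule terminates_weaken) (auto simp: I_def M_def P algebra_simps)
qed

text \<open>Each summand is the integral from \<open>integral_linear_square\<close> over one
  interval of length 2 pi / N, divided by 2 pi.\<close>

definition norm_program :: com where
  "norm_program = Seq (for_loop 1 (IReg 0) (accumulate 6 (INum 0)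
     (Div (Add (Add (Mul (Cell 5 (IReg 1)) (Cell 5 (IReg 1)))
                    (Mul (Cell 5 (IReg 1)) (Cell 5 (IAdd (IReg 1) (INum 1)))))
               (Mul (Cell 5 (IAdd (IReg 1) (INum 1))) (Cell 5 (IAdd (IReg 1) (INum 1)))))
          (Mul (OfIdx (INum 3)) (OfIdx (IReg 0))))))
     (RSet 0 (INum 0) (Sqrt (Cell 6 (INum 0))))"

lemma norm_program:
  assumes s: "fst s 0 = N" "snd s 6 = (\<lambda>_. 0)" and c: "\<And>k. k \<le> N \<Longrightarrow> snd s 5 k = c k"
  shows "terminates \<rho>1 \<rho>2 norm_program s (N * 3 + 3)
    (\<lambda>s'. snd s' 0 0 = sqrt (\<Sum>k<N. ((c k)\<^sup>2 + c k * c (Suc k) + (c (Suc k))\<^sup>2) / (3 * real N)))"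
proof -
  define S where "S = (\<lambda>k. \<Sum>k'<k. ((c k')\<^sup>2 + c k' * c (Suc k') + (c (Suc k'))\<^sup>2) / (3 * real N))"
  define I where "I = (\<lambda>k (s :: state). fst s 0 = N \<and> fst s 1 = k \<and> (\<forall>k\<le>N. snd s 5 k = c k) \<and> snd s 6 0 = S k)"
  have "terminates \<rho>1 \<rho>2 norm_program s ((N * (1 + 2) + 2) + 1) (\<lambda>s'. snd s' 0 0 = sqrt (S N))"
    unfolding norm_program_def
  proof (rule terminates_Seq, rule terminates_for_loop)
    show "I 0 ((fst s)(1 := 0), snd s)" using s c by (simp add: I_def S_def)
  next
    fix k s assume "k < N" "I k s"
    then show "terminates \<rho>1 \<rho>2 (accumulate 6 (INum 0)
     (Div (Add (Add (Mul (Cell 5 (IReg 1)) (Cell 5 (IReg 1)))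
                    (Mul (Cell 5 (IReg 1)) (Cell 5 (IAdd (IReg 1) (INum 1)))))
               (Mul (Cell 5 (IAdd (IReg 1) (INum 1))) (Cell 5 (IAdd (IReg 1) (INum 1)))))
          (Mul (OfIdx (INum 3)) (OfIdx (IReg 0))))) s 1
      (\<lambda>s'. fst s' 1 = k \<and> I (Suc k) ((fst s')(1 := Suc k), snd s'))"
      unfolding accumulate_def
      by (intro terminates_RSet) (simp add: I_def S_def power2_eq_square)
  next
    fix s assume "I N s"
    then show "terminates \<rho>1 \<rho>2 (RSet 0 (INum 0) (Sqrt (Cell 6 (INum 0)))) s 1
        (\<lambda>s'. snd s' 0 0 = sqrt (S N))"
      by (intro terminates_RSet) (simp add: I_def)
  qed (auto simp: I_def)
  then show ?thesis by (rule terminates_weaken) (auto simp: S_def)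
qed

definition dist_program :: com where
  "dist_program = Seq grid_program (Seq means_program (Seq nodes_program norm_program))"

section \<open>From star shapes to correctness of the whole program\<close>

lemma lipschitz_profile_radius:
  assumes X: "X \<in> lipschitz_star_shapes \<eta>" and \<eta>: "0 \<le> \<eta>"
  shows "lipschitz_profile (radius X) \<eta>"
proof
  have std: "standardized_shape X" and star: "\<And>x. x \<in> X \<Longrightarrow> closed_segment 0 x \<subseteq> X"
    and pos: "\<And>\<theta>. 0 < radius X \<theta>"
    and lip: "(\<eta> * (1 / (2 * pi)))-lipschitz_on UNIV (radius X)"
    using X by (auto simp: lipschitz_star_shapes_def standardized_star_shape_def)
  \<comment> \<open>The origin makes the set in the definition of \<open>radius\<close> nonempty, as
    its supremum requires in order to be bounded by 1.\<close>
  have zero: "0 \<in> X" using std star by (force simp: standardized_shape_def)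
  fix \<theta> \<theta>' :: real
  show "0 \<le> \<eta>" by fact
  show "radius X (\<theta> + 2 * pi) = radius X \<theta>" by (simp add: radius_def)
  show "0 \<le> radius X \<theta>" using pos[of \<theta>] by simp
  show "radius X \<theta> \<le> 1"
    unfolding radius_def
  proof (rule cSup_least)
    show "{r. 0 \<le> r \<and> r *\<^sub>R vector [cos \<theta>, sin \<theta>] \<in> X} \<noteq> {}" using zero by (auto intro!: exI[of _ 0])
    fix r assume r: "r \<in> {r. 0 \<le> r \<and> r *\<^sub>R vector [cos \<theta>, sin \<theta>] \<in> X}"
    have "norm (vector [cos \<theta>, sin \<theta>] :: real^2) = 1"
      by (simp add: norm_vec_def L2_set_def sum_2)
    moreover have "norm (r *\<^sub>R (vector [cos \<theta>, sin \<theta>] :: real^2)) \<le> 1"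
      using r std by (auto simp: standardized_shape_def)
    ultimately show "r \<le> 1" using r by simp
  qed
  show "\<bar>radius X \<theta> - radius X \<theta>'\<bar> \<le> \<eta> / (2 * pi) * \<bar>\<theta> - \<theta>'\<bar>"
    using lipschitz_onD[OF lip, of \<theta> \<theta>'] by (simp add: dist_real_def)
qed

lemma dist_program_correct:
  assumes \<eta>: "0 < \<eta>" and \<epsilon>: "0 < \<epsilon>" and \<Phi>: "\<And>z. \<Phi> z = exp (- z)"
    and X1: "X1 \<in> lipschitz_star_shapes \<eta>" and X2: "X2 \<in> lipschitz_star_shapes \<eta>"
  shows "\<exists>D t. outputs_in_time dist_program \<eta> \<epsilon> X1 X2 D t \<and> t \<le> 50 * (grid_size \<eta> \<epsilon>)\<^sup>2 \<and>
    \<bar>D - sketch_dist \<Phi> X1 X2\<bar> \<le> \<epsilon>"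
proof -
  interpret P1: lipschitz_profile "radius X1" \<eta> by (rule lipschitz_profile_radius) (use X1 \<eta> in auto)
  interpret P2: lipschitz_profile "radius X2" \<eta> by (rule lipschitz_profile_radius) (use X2 \<eta> in auto)
  define N where "N = grid_size \<eta> \<epsilon>"
  have N: "1 \<le> N" "12 * (\<eta>\<^sup>2 + \<eta>) \<le> real N * real N * \<epsilon>" using grid_size[OF \<epsilon>] by (auto simp: N_def)
  define c where "c = (\<lambda>k. P1.node_corr N k - P2.node_corr N k)"
  define D where "D = sqrt (\<Sum>k<N. ((c k)\<^sup>2 + c k * c (Suc k) + (c (Suc k))\<^sup>2) / (3 * real N))"
  have nodes: "node_sums A1 B1 A2 B2 N k = c k"
    if "k \<le> N" and "\<And>l. l < 2 * N \<Longrightarrow> A1 l = block_mean P1.decay N l \<and> B1 l = block_mean P1.growth N l \<and>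
         A2 l = block_mean P2.decay N l \<and> B2 l = block_mean P2.growth N l" for A1 B1 A2 B2 k
  proof -
    have "node_sums A1 B1 A2 B2 N k = (\<Sum>j<N. block_mean P1.decay N j * block_mean P1.growth N (j + k) / real N
        - block_mean P2.decay N j * block_mean P2.growth N (j + k) / real N)"
      unfolding node_sums_def using that by (intro sum.cong) (auto simp: diff_divide_distrib)
    then show ?thesis by (simp add: c_def P1.node_corr_def P2.node_corr_def sum_subtractf)
  qed
  let ?r1 = "radius X1" and ?r2 = "radius X2"
  have "terminates ?r1 ?r2 dist_program (init_state \<eta> \<epsilon>)
      (2 * N + ((2 * N * (N * 6 + 4) + 2) + (((N + 1) * (N * 3 + 4) + 2) + (N * 3 + 3))))
      (\<lambda>s. snd s 0 0 = D)"
    unfolding dist_program_def D_def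
  proof (rule terminates_Seq[OF grid_program[OF \<epsilon>, of _ _ \<eta>, folded N_def]], rule terminates_Seq[OF means_program])
    fix s s' :: state
    assume s': "fst s' 0 = N \<and>
       (\<forall>l < 2 * N. snd s' 1 l = block_mean (\<lambda>\<theta>. exp (- ?r1 \<theta>)) N l \<and>
         snd s' 2 l = block_mean (\<lambda>\<theta>. exp (?r1 \<theta>)) N l \<and>
         snd s' 3 l = block_mean (\<lambda>\<theta>. exp (- ?r2 \<theta>)) N l \<and>
         snd s' 4 l = block_mean (\<lambda>\<theta>. exp (?r2 \<theta>)) N l) \<and>
       snd s' 5 = (\<lambda>_. 0) \<and> snd s' 6 = (\<lambda>_. 0)"
    then have "node_sums (snd s' 1) (snd s' 2) (snd s' 3) (snd s' 4) N k = c k" if "k \<le> N" for k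
      using that unfolding P1.decay_def[abs_def, symmetric] P1.growth_def[abs_def, symmetric]
        P2.decay_def[abs_def, symmetric] P2.growth_def[abs_def, symmetric]
      by (intro nodes) auto
    then show "terminates ?r1 ?r2 (Seq nodes_program norm_program) s' (((N + 1) * (N * 3 + 4) + 2) + (N * 3 + 3))
      (\<lambda>s. snd s 0 0 = sqrt (\<Sum>k<N. ((c k)\<^sup>2 + c k * c (Suc k) + (c (Suc k))\<^sup>2) / (3 * real N)))"
      using s' by (intro terminates_Seq[OF nodes_program] norm_program) auto
  qed (auto simp: init_state_def)
  then obtain t s' where t: "exec ?r1 ?r2 dist_program (init_state \<eta> \<epsilon>) t s'" "snd s' 0 0 = D"
      "t \<le> 2 * N + ((2 * N * (N * 6 + 4) + 2) + (((N + 1) * (N * 3 + 4) + 2) + (N * 3 + 3)))"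
    unfolding terminates_def by blast
  have "t \<le> 15 * N\<^sup>2 + 20 * N + 11" using t(3) by (simp add: power2_eq_square algebra_simps)
  also have "\<dots> \<le> 50 * N\<^sup>2"
  proof -
    have "1 \<le> N\<^sup>2" "N \<le> N\<^sup>2" using N(1) by (auto simp: power2_eq_square)
    then show ?thesis by linarith
  qed
  finally have time: "t \<le> 50 * N\<^sup>2" .
  have sketch: "sketch \<Phi> X1 = P1.corr" "sketch \<Phi> X2 = P2.corr"
    by (simp_all add: fun_eq_iff sketch_def P1.corr_def P2.corr_def \<Phi> P1.decay_def P1.growth_def
        P2.decay_def P2.growth_def flip: exp_add)
  let ?E = "exp 1 * (5 / 4 * \<eta>\<^sup>2 + 2 * \<eta>) / (real N)\<^sup>2"
  have "\<bar>D - sqrt (1 / (2 * pi) * integral {0..2 * pi} (\<lambda>x. (P1.corr x - P2.corr x)\<^sup>2))\<bar> \<le> 2 * ?E"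
    unfolding D_def
  proof (rule L2_norm_piecewise_linear_error)
    show "0 < N" using N by simp
    show "continuous_on A (\<lambda>x. P1.corr x - P2.corr x)" for A
      by (intro continuous_intros P1.cont_corr P2.cont_corr)
    fix k x assume x: "0 \<le> x" "x \<le> 2 * pi / real N"
    define t where "t = x / (2 * pi / real N)"
    \<comment> \<open>Interpolation is linear in the node values, so the error for the difference of
      the sketches is the difference of the two individual errors.\<close>
    have split: "P1.corr y - P2.corr y - (c k + t * (c (Suc k) - c k))
      = (P1.corr y - (P1.node_corr N k + t * (P1.node_corr N (Suc k) - P1.node_corr N k)))
      - (P2.corr y - (P2.node_corr N k + t * (P2.node_corr N (Suc k) - P2.node_corr N k)))" for y
      by (simp add: c_def algebra_simps)
    have "\<bar>P1.corr (2 * pi * real k / real N + x) - P2.corr (2 * pi * real k / real N + x)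
        - (c k + t * (c (Suc k) - c k))\<bar> \<le> ?E + ?E"
      unfolding split
      by (rule order_trans[OF abs_triangle_ineq4 add_mono])
        (unfold t_def, rule P1.corr_interpolation_error P2.corr_interpolation_error; use N x in simp)+
    then show "\<bar>P1.corr (2 * pi * real k / real N + x) - P2.corr (2 * pi * real k / real N + x)
        - (c k + x / (2 * pi / real N) * (c (Suc k) - c k))\<bar> \<le> 2 * ?E"
      unfolding t_def by (simp only: mult_2)
  qed
  also have "\<dots> \<le> \<epsilon>"
  proof -
    \<comment> \<open>Here the constant 12 of \<open>grid_size\<close> is accounted for: with e
      \<le> 3 the left side is at most 7.5 \<eta>^2 + 12 \<eta>.\<close>
    have "2 * (exp 1 * (5 / 4 * \<eta>\<^sup>2 + 2 * \<eta>)) \<le> 2 * (3 * (5 / 4 * \<eta>\<^sup>2 + 2 * \<eta>))"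
      using exp_le \<eta> by (intro mult_left_mono mult_right_mono) auto
    also have "\<dots> \<le> 12 * (\<eta>\<^sup>2 + \<eta>)" by simp
    also have "\<dots> \<le> (real N)\<^sup>2 * \<epsilon>" using N by (simp add: power2_eq_square)
    finally show ?thesis using N(1) by (simp add: field_simps)
  qed
  finally have "\<bar>D - sketch_dist \<Phi> X1 X2\<bar> \<le> \<epsilon>"
    by (simp add: sketch_dist_def sketch)
  then show ?thesis
    using t time unfolding outputs_in_time_def N_def by blast
qed

theorem theorem4p4:
  fixes \<Phi> :: "real \<Rightarrow> real"
  assumes "\<And>z. \<Phi> z = exp (- z)"
  shows "\<exists>(P :: com) (T :: real \<Rightarrow> real \<Rightarrow> nat).
    (\<forall>\<eta>>0. \<forall>\<epsilon>>0. \<forall>X1 \<in> lipschitz_star_shapes \<eta>. \<forall>X2 \<in> lipschitz_star_shapes \<eta>.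
       \<exists>D t. outputs_in_time P \<eta> \<epsilon> X1 X2 D t \<and> t \<le> T \<eta> \<epsilon> \<and>
             \<bar>D - sketch_dist \<Phi> X1 X2\<bar> \<le> \<epsilon>) \<and>
    (\<forall>\<eta>0>0. \<exists>C>0. \<forall>\<eta> \<epsilon>. 0 < \<eta> \<and> \<eta> \<le> \<eta>0 \<and> 0 < \<epsilon> \<and> \<eta> * \<epsilon> \<le> 1 / 2 \<longrightarrow>
       real (T \<eta> \<epsilon>) \<le> C * (1 / (\<eta> * \<epsilon>) * ln (1 / (\<eta> * \<epsilon>))))"
proof (intro exI[of _ dist_program] exI[of _ "\<lambda>\<eta> \<epsilon>. 50 * (grid_size \<eta> \<epsilon>)\<^sup>2"] conjI allI impI ballI)
  fix \<eta> \<epsilon> :: real and X1 X2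
  assume "0 < \<eta>" "0 < \<epsilon>" "X1 \<in> lipschitz_star_shapes \<eta>" "X2 \<in> lipschitz_star_shapes \<eta>"
  then show "\<exists>D t. outputs_in_time dist_program \<eta> \<epsilon> X1 X2 D t \<and> t \<le> 50 * (grid_size \<eta> \<epsilon>)\<^sup>2 \<and>
      \<bar>D - sketch_dist \<Phi> X1 X2\<bar> \<le> \<epsilon>"
    using assms by (intro dist_program_correct)
next
  fix \<eta>0 :: real assume \<eta>0: "0 < \<eta>0"
  \<comment> \<open>The factor 200 is 50 from the step count times 4 from
    \<open>grid_size_upper\<close>. The cubic and quadratic terms arise from writing 1/\<epsilon> as
    \<eta> times 1/(\<eta> \<epsilon>).\<close>
  define K where "K = 200 * (1 + 12 * (\<eta>0^3 + \<eta>0\<^sup>2))"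
  have K: "0 < K" using \<eta>0 by (simp add: K_def add_pos_pos)
  show "\<exists>C>0. \<forall>\<eta> \<epsilon>. 0 < \<eta> \<and> \<eta> \<le> \<eta>0 \<and> 0 < \<epsilon> \<and> \<eta> * \<epsilon> \<le> 1 / 2 \<longrightarrow>
       real (50 * (grid_size \<eta> \<epsilon>)\<^sup>2) \<le> C * (1 / (\<eta> * \<epsilon>) * ln (1 / (\<eta> * \<epsilon>)))"
  proof (intro exI[of _ "K / ln 2"] conjI allI impI)
    show "0 < K / ln 2" using K by simp
    fix \<eta> \<epsilon> :: real
    assume A: "0 < \<eta> \<and> \<eta> \<le> \<eta>0 \<and> 0 < \<epsilon> \<and> \<eta> * \<epsilon> \<le> 1 / 2"
    define x where "x = 1 / (\<eta> * \<epsilon>)"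
    have x: "2 \<le> x" using A by (simp add: x_def field_simps)
    have "12 * (\<eta>\<^sup>2 + \<eta>) / \<epsilon> = 12 * (\<eta>^3 + \<eta>\<^sup>2) * x"
      using A by (simp add: x_def field_simps power2_eq_square power3_eq_cube)
    also have "\<dots> \<le> 12 * (\<eta>0^3 + \<eta>0\<^sup>2) * x"
      using A x by (intro mult_right_mono mult_left_mono add_mono power_mono) auto
    finally have "1 + 12 * (\<eta>\<^sup>2 + \<eta>) / \<epsilon> \<le> (1 + 12 * (\<eta>0^3 + \<eta>0\<^sup>2)) * x"
      using x by (simp add: distrib_right)
    then have "200 * (1 + 12 * (\<eta>\<^sup>2 + \<eta>) / \<epsilon>) \<le> K * x"
      unfolding K_def mult.assoc by (rule mult_left_mono) simp
    moreover have "real (50 * (grid_size \<eta> \<epsilon>)\<^sup>2) \<le> 200 * (1 + 12 * (\<eta>\<^sup>2 + \<eta>) / \<epsilon>)"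
      using mult_left_mono[OF grid_size_upper[of \<epsilon> \<eta>], of 50] A by simp
    ultimately have "real (50 * (grid_size \<eta> \<epsilon>)\<^sup>2) \<le> K * x" by linarith
    \<comment> \<open>The time is already linear in x = 1/(\<eta> \<epsilon>). Since x \<ge> 2, the
      factor ln x / ln 2 is at least 1 and may be inserted.\<close>
    also have "\<dots> \<le> K * x * (ln x / ln 2)"
      using mult_left_mono[of 1 "ln x / ln 2" "K * x"] K x by simp
    also have "\<dots> = K / ln 2 * (x * ln x)" by simp
    finally show "real (50 * (grid_size \<eta> \<epsilon>)\<^sup>2) \<le> K / ln 2 * (1 / (\<eta> * \<epsilon>) * ln (1 / (\<eta> * \<epsilon>)))"
      unfolding x_def .
  qed
qed

end
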